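(* Let $X$ be a complex Banach space with open unit ball $\mathbb{B}$, let $A$ be a bounded strongly accretive linear operator on $X$, and let $g\in\mathrm{Hol}(\mathbb{D},\mathbb{C})$ be biholomorphic onto its image with $g\prec g_0$ and $\overline{V(A)}\subset g(\mathbb{D})$, where $g_0(z)=\frac{1+z}{1-z}$. Let $h\in\mathcal{N}_A(g)$ and let $J_r$ be the non-linear resolvent of $h$ for some $r>0$. Put $B_r=DJ_r(0)=(\mathrm{Id}+rA)^{-1}$ and $\rho_r=\|B_r\|$. For $x\in\partial\mathbb{B}$ and $\ell_r\in T(B_rx)$, let $$\widetilde{a}_2^2:=\ell_r\left((\mathrm{Id}+rA)\frac1{2!}D^2J_r(0)\left[x,(\mathrm{Id}+rA)\frac1{2!}D^2J_r(0)[x^2]\right]\right),$$ $$a_2:=\ell_r\left((\mathrm{Id}+rA)\frac1{2!}D^2J_r(0)[x^2]\right),\qquad a_3:=\ell_r\left((\mathrm{Id}+rA)\frac1{3!}D^3J_r(0)[x^3]\right).$$ Then for any $\nu\in\mathbb{C}$ we have $$\left|a_3-2\widetilde{a}_2^2-(\nu-2)a_2^2\right|\le r|q_1|\,\|B_rx\|\,\rho_r^2\max\left(1,Q_r(x)\right),$$ where $$Q_r(x):=\left|\frac{q_2}{q_1}-(2-\nu)rq_1\|B_rx\|\right|$$ and $q_1,q_2$ are the Taylor coefficients (of $t$ and $t^2$, respectively, at $t=0$) of $\widehat{g}(t)=g\left(\frac{\tau-t}{1-t\overline{\tau}}\right)$ with $\tau=g^{-1}\left(\frac{\ell_r(AB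_rx)}{\|B_rx\|}\right)$.
   Context: $\mathbb{D}$ is the open unit disk in $\mathbb{C}$; $\mathrm{Hol}(U,Y)$ is the set of holomorphic mappings from $U$ to $Y$. For $x\in X\setminus\{0\}$, $T(x)=\{\ell_x\in X^*:\|\ell_x\|=1,\ \ell_x(x)=\|x\|\}$. $D^nf(0)$ is the $n$-th Fréchet derivative at $0$, a bounded symmetric $n$-linear operator, and $D^nf(0)[x^n]=D^nf(0)[x,\dots,x]$. For a bounded linear operator $A$, $V(A)=\{\ell_x(Ax):\|x\|=1,\ \ell_x\in T(x)\}$ is its numerical range; $A$ is strongly accretive if there is $k>0$ with $\mathrm{Re}\,\ell_x(Ax)\ge k\|x\|$ for all $x\in X\setminus\{0\}$, $\ell_x\in T(x)$. For functions on $\mathbb{D}$, $g\prec g_0$ (subordination) means $g=g_0\circ\omega$ for some holomorphic $\omega:\mathbb{D}\to\mathbb{D}$ with $\omega(0)=0$. $\mathcal{N}_A$ is the set of $h\in\mathrm{Hol}(\mathbb{B},X)$ with $h(0)=0$, $Dh(0)=A$ and $\mathrm{Re}\,\ell_x(h(x))>0$ for all $x\in\mathbb{B}\setminus\{0\}$, $\ell_x\in T(x)$. $\mathcal{N}_A(g)$ is the set of $h\in\mathcal{N}_A$ with $\frac{\ell_x(h(x))}{\|x\|}\in g(\mathbb{D})$ for all $x\in\mathbb{B}\setminus\{0\}$, $\ell_x\in T(x)$. Every $h\in\mathcal{N}_A$ is holomorphically accretive, and it is a known fact that then for every $r>0$ one has $(\mathrm{Id}+rh)(\mathbb{B})\supseteq\mathbb{B}$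 and the non-linear resolvent $J_r:=(\mathrm{Id}+rh)^{-1}$ is a well-defined holomorphic self-mapping of $\mathbb{B}$: $w=J_r(x)$ is the unique solution $w\in\mathbb{B}$ of $w+rh(w)=x$, $x\in\mathbb{B}$. The symbol $\widetilde{a}_2^2$ denotes a single complex number (not the square of another defined quantity), while $a_2^2=(a_2)^2$. *)

theory Defs
  imports "HOL-Analysis.Analysis"
begin

class complex_normed_vector = real_normed_vector +
  fixes scaleC :: "complex \<Rightarrow> 'a \<Rightarrow> 'a" (infixr \<open>*\<^sub>C\<close> 75)
  assumes scaleC_add_right: "c *\<^sub>C (x + y) = c *\<^sub>C x + c *\<^sub>C y"
    and scaleC_add_left: "(c + d) *\<^sub>C x = c *\<^sub>C x + d *\<^sub>C x"
    and scaleC_scaleC: "c *\<^sub>C d *\<^sub>C x = (c * d) *\<^sub>C x"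
    and scaleR_scaleC: "r *\<^sub>R x = complex_of_real r *\<^sub>C x"
    and norm_scaleC: "norm (c *\<^sub>C x) = cmod c * norm x"

class complex_banach = complex_normed_vector + banach

instantiation complex :: complex_banach
begin

definition scaleC_complex :: "complex \<Rightarrow> complex \<Rightarrow> complex" where
  "scaleC_complex c x = c * x"

instance
  by standard (simp_all add: scaleC_complex_def algebra_simps norm_mult scaleR_conv_of_real)

end

definition bounded_clinear :: "('a::complex_normed_vector \<Rightarrow> 'b::complex_normed_vector) \<Rightarrow> bool" where
  "bounded_clinear f \<longleftrightarrow> bounded_linear f \<and> (\<forall>c x. f (c *\<^sub>C x) = c *\<^sub>C f x)"

text \<open>Complex Frechet differentiability at every point of \<open>U\<close>, which is meant to be open.\<close>

definition Hol :: "'a::complex_normed_vector set \<Rightarrow> ('a \<Rightarrow> 'b::complex_normed_vector) set" where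
  "Hol U = {f. \<forall>x\<in>U. \<exists>F. bounded_clinear F \<and> (f has_derivative F) (at x)}"

text \<open>The Frechet derivative as an operator-valued map, so that it can be iterated:
  \<open>fderiv (fderiv f) x u v\<close> is \<open>D\<^sup>2f(x)[u,v]\<close>. It is the derivative over the reals;
  for maps in \<open>Hol U\<close> it agrees with the complex one on \<open>U\<close>.\<close>

definition fderiv ::
  "('a::real_normed_vector \<Rightarrow> 'b::real_normed_vector) \<Rightarrow> 'a \<Rightarrow> 'a \<Rightarrow>\<^sub>L 'b" where
  "fderiv f x = Blinfun (frechet_derivative f (at x))"

definition D2 ::
  "('a::real_normed_vector \<Rightarrow> 'b::real_normed_vector) \<Rightarrow> 'a \<Rightarrow> 'a \<Rightarrow> 'a \<Rightarrow> 'b" where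
  "D2 f x u v = blinfun_apply (blinfun_apply (fderiv (fderiv f) x) u) v"

definition D3 ::
  "('a::real_normed_vector \<Rightarrow> 'b::real_normed_vector) \<Rightarrow> 'a \<Rightarrow> 'a \<Rightarrow> 'a \<Rightarrow> 'a \<Rightarrow> 'b" where
  "D3 f x u v w =
     blinfun_apply (blinfun_apply (blinfun_apply (fderiv (fderiv (fderiv f)) x) u) v) w"

text \<open>The set \<open>T(x)\<close>; only meaningful for \<open>x \<noteq> 0\<close>.\<close>

definition support_functionals :: "'a::complex_normed_vector \<Rightarrow> ('a \<Rightarrow> complex) set" where
  "support_functionals x =
     {l. bounded_clinear l \<and> onorm l = 1 \<and> l x = complex_of_real (norm x)}"

definition numerical_range :: "('a::complex_normed_vector \<Rightarrow> 'a) \<Rightarrow> complex set" where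
  "numerical_range A = {l (A x) | l x. norm x = 1 \<and> l \<in> support_functionals x}"

definition strongly_accretive :: "('a::complex_normed_vector \<Rightarrow> 'a) \<Rightarrow> bool" where
  "strongly_accretive A \<longleftrightarrow>
     (\<exists>k>0. \<forall>x. x \<noteq> 0 \<longrightarrow> (\<forall>l\<in>support_functionals x. Re (l (A x)) \<ge> k * norm x))"

definition subordinate :: "(complex \<Rightarrow> complex) \<Rightarrow> (complex \<Rightarrow> complex) \<Rightarrow> bool"
    (infix \<open>\<prec>\<close> 50) where
  "g \<prec> g0 \<longleftrightarrow>
     (\<exists>\<omega>. \<omega> holomorphic_on ball 0 1 \<and> \<omega> ` ball 0 1 \<subseteq> ball 0 1 \<and> \<omega> 0 = 0 \<and>
          (\<forall>z\<in>ball 0 1. g z = g0 (\<omega> z)))"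

definition biholomorphic_onto_image :: "complex set \<Rightarrow> (complex \<Rightarrow> complex) \<Rightarrow> bool" where
  "biholomorphic_onto_image U g \<longleftrightarrow>
     g holomorphic_on U \<and> inj_on g U \<and> inv_into U g holomorphic_on (g ` U)"

definition class_N :: "('a::complex_normed_vector \<Rightarrow> 'a) \<Rightarrow> ('a \<Rightarrow> 'a) set" where
  "class_N A = {h \<in> Hol (ball 0 1). h 0 = 0 \<and> (h has_derivative A) (at 0) \<and>
     (\<forall>x\<in>ball 0 1 - {0}. \<forall>l\<in>support_functionals x. Re (l (h x)) > 0)}"

definition class_N_sub ::
  "('a::complex_normed_vector \<Rightarrow> 'a) \<Rightarrow> (complex \<Rightarrow> complex) \<Rightarrow> ('a \<Rightarrow> 'a) set" where
  "class_N_sub A g = {h \<in> class_N A.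
     \<forall>x\<in>ball 0 1 - {0}. \<forall>l\<in>support_functionals x. l (h x) / complex_of_real (norm x) \<in> g ` ball 0 1}"

text \<open>For accretive \<open>h\<close> the solution \<open>w\<close> exists and is unique whenever \<open>x\<close> lies in the unit ball;
  elsewhere the value is arbitrary.\<close>

definition resolvent :: "('a::real_normed_vector \<Rightarrow> 'a) \<Rightarrow> real \<Rightarrow> 'a \<Rightarrow> 'a" where
  "resolvent h r x = (THE w. w \<in> ball 0 1 \<and> w + r *\<^sub>R h w = x)"

definition taylor_coeff :: "(complex \<Rightarrow> complex) \<Rightarrow> nat \<Rightarrow> complex" where
  "taylor_coeff f n = (deriv ^^ n) f 0 / fact n"

end

theory Submission
  imports Defs "HOL-Complex_Analysis.Complex_Analysis"
begin

text \<open>Differentiating \<open>J + r h(J) = id\<close> at the origin three times gives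
  \<open>a\<^sub>2 = - (r/2) l(D\<^sup>2h(0)[y,y])\<close> and \<open>a\<^sub>3 - 2 a2t = - (r/6) l(D\<^sup>3h(0)[y,y,y])\<close> with \<open>y = B x\<close>: the mixed
  term \<open>D\<^sup>2h(0)[y, D\<^sup>2J(0)[x,x]]\<close> of \<open>a\<^sub>3\<close> is exactly cancelled by \<open>2 a2t\<close>. Put \<open>u = y/\<parallel>y\<parallel>\<close>. The
  function \<open>l(h(t u))/t\<close> maps the disc into \<open>g(D)\<close>, hence equals \<open>ghat \<circ> \<omega>\<close> for a Schwarz function
  \<open>\<omega>(t) = c\<^sub>1 t + c\<^sub>2 t^2 + \<dots>\<close>, and the bound reduces to \<open>|c\<^sub>2| \<le> 1 - |c\<^sub>1|^2\<close>.

  That complex Frechet differentiable maps are infinitely differentiable follows from scalar Cauchy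
  estimates for \<open>l(f(x + t v))\<close>, uniform over functionals \<open>l\<close> of norm 1, by Hahn-Banach. The
  resolvent is obtained near the origin only, by contraction; its uniqueness in the whole ball comes
  from \<open>\<parallel>w\<parallel> \<le> \<parallel>w + r h(w)\<parallel>\<close>, which makes every solution small.\<close>

subsection \<open>Complex normed spaces\<close>

lemma scaleC_zero_right [simp]: "c *\<^sub>C (0::'a::complex_normed_vector) = 0"
  by (metis add_cancel_right_right scaleC_add_right)

lemma scaleC_zero_left [simp]: "0 *\<^sub>C (x::'a::complex_normed_vector) = 0"
  by (metis of_real_0 scaleR_scaleC scaleR_zero_left)

lemma scaleC_one [simp]: "1 *\<^sub>C (x::'a::complex_normed_vector) = x"
  by (metis of_real_1 scaleR_scaleC scaleR_one)

lemma scaleC_minus_right: "c *\<^sub>C (- x) = - (c *\<^sub>C (x::'a::complex_normed_vector))"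
  by (metis add.right_inverse add_eq_0_iff scaleC_add_right scaleC_zero_right)

lemma scaleC_diff_right: "c *\<^sub>C (x - y) = c *\<^sub>C x - c *\<^sub>C (y::'a::complex_normed_vector)"
  using scaleC_add_right[of c x "- y"] by (simp add: scaleC_minus_right)

lemma scaleC_scaleR: "c *\<^sub>C (r *\<^sub>R x) = r *\<^sub>R (c *\<^sub>C (x::'a::complex_normed_vector))"
  by (simp add: scaleR_scaleC scaleC_scaleC mult.commute)

lemma bounded_bilinear_scaleC:
  "bounded_bilinear (\<lambda>c (x::'a::complex_normed_vector). c *\<^sub>C x)"
  by (rule bounded_bilinear.intro)
     (auto simp: scaleC_add_left scaleC_add_right scaleC_scaleR norm_scaleC
        scaleR_scaleC scaleC_scaleC scaleC_complex_def mult.commute intro!: exI[of _ 1])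

lemma bounded_linear_scaleC_right: "bounded_linear (\<lambda>x::'a::complex_normed_vector. c *\<^sub>C x)"
  by (rule bounded_bilinear.bounded_linear_right[OF bounded_bilinear_scaleC])

lemma bounded_linear_scaleC_left: "bounded_linear (\<lambda>c. c *\<^sub>C (x::'a::complex_normed_vector))"
  by (rule bounded_bilinear.bounded_linear_left[OF bounded_bilinear_scaleC])

lemma bounded_clinear_linear: "bounded_clinear f \<Longrightarrow> bounded_linear f"
  by (simp add: bounded_clinear_def)

lemma bounded_clinear_scaleC: "bounded_clinear f \<Longrightarrow> f (c *\<^sub>C x) = c *\<^sub>C f x"
  by (simp add: bounded_clinear_def)

text \<open>The scalar acts on the values, so the real-linear operators into a complex space form a
  complex space. Hence \<open>fderiv f\<close> is again a map between complex spaces and the theory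
  of \<open>Hol\<close> applies to it repeatedly.\<close>

instantiation blinfun :: (real_normed_vector, complex_normed_vector) complex_normed_vector
begin

definition scaleC_blinfun :: "complex \<Rightarrow> ('a \<Rightarrow>\<^sub>L 'b) \<Rightarrow> 'a \<Rightarrow>\<^sub>L 'b" where
  "scaleC_blinfun c f = Blinfun (\<lambda>x. c *\<^sub>C blinfun_apply f x)"

lemma blinfun_apply_scaleC: "blinfun_apply (c *\<^sub>C f) x = c *\<^sub>C blinfun_apply f x"
  for f :: "'a \<Rightarrow>\<^sub>L 'b"
  unfolding scaleC_blinfun_def
  by (subst bounded_linear_Blinfun_apply)
     (auto intro: bounded_linear_compose[OF bounded_linear_scaleC_right blinfun.bounded_linear_right])

lemma norm_scaleC_blinfun_le: "norm (c *\<^sub>C f) \<le> cmod c * norm f"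
  for f :: "'a \<Rightarrow>\<^sub>L 'b"
  by (rule norm_blinfun_bound)
     (auto simp: blinfun_apply_scaleC norm_scaleC mult.assoc intro!: mult_left_mono norm_blinfun)

instance
proof
  fix c d :: complex and r :: real and f g :: "'a \<Rightarrow>\<^sub>L 'b"
  show "c *\<^sub>C (f + g) = c *\<^sub>C f + c *\<^sub>C g"
    by (rule blinfun_eqI) (simp add: blinfun_apply_scaleC blinfun.add_left scaleC_add_right)
  show "(c + d) *\<^sub>C f = c *\<^sub>C f + d *\<^sub>C f"
    by (rule blinfun_eqI) (simp add: blinfun_apply_scaleC blinfun.add_left scaleC_add_left)
  show "c *\<^sub>C d *\<^sub>C f = (c * d) *\<^sub>C f" for c d
    by (rule blinfun_eqI) (simp add: blinfun_apply_scaleC scaleC_scaleC)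
  show "r *\<^sub>R f = complex_of_real r *\<^sub>C f"
    by (rule blinfun_eqI) (simp add: blinfun_apply_scaleC blinfun.scaleR_left scaleR_scaleC)
  show "norm (c *\<^sub>C f) = cmod c * norm f"
  proof (cases "c = 0")
    case True
    then show ?thesis using norm_scaleC_blinfun_le[of 0 f] by simp
  next
    case False
    have "f = inverse c *\<^sub>C c *\<^sub>C f"
      by (rule blinfun_eqI) (simp add: blinfun_apply_scaleC scaleC_scaleC False)
    then have "norm f \<le> cmod (inverse c) * norm (c *\<^sub>C f)"
      by (metis norm_scaleC_blinfun_le)
    then have "cmod c * norm f \<le> norm (c *\<^sub>C f)"
      using False by (simp add: norm_divide field_simps)
    then show ?thesis using norm_scaleC_blinfun_le[of c f] by simp
  qed
qed

end

instance blinfun :: (real_normed_vector, complex_banach) complex_banach ..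

text \<open>Transports a functional on values to one on operators, so that scalar arguments also
  reach the iterated derivatives.\<close>

lemma bounded_clinear_blinfun_apply: "bounded_clinear l \<Longrightarrow> bounded_clinear (\<lambda>T. l (blinfun_apply T v))"
  unfolding bounded_clinear_def
  by (auto simp: blinfun_apply_scaleC intro: bounded_linear_compose[OF _ blinfun.bounded_linear_left])

subsection \<open>Support functionals\<close>

text \<open>Zorn's lemma is applied to graphs: \<open>P\<close> consists of the subspaces of the
  product that contain \<open>(x, norm x)\<close> and lie below the norm. Single-valuedness is not
  built into \<open>P\<close>, since domination by the norm forces it.\<close>

lemma hahn_banach_real:
  fixes x :: "'a::real_normed_vector"
  shows "\<exists>f. linear f \<and> f x = norm x \<and> (\<forall>y. f y \<le> norm y)"
proof -
  define P where "P = {G :: ('a \<times> real) set. subspace G \<and> (x, norm x) \<in> G \<and> (\<forall>(y, a)\<in>G. a \<le> norm y)}"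
  have "span {(x, norm x)} \<in> P"
    unfolding P_def
  proof (intro CollectI conjI)
    show "\<forall>(y, a)\<in>span {(x, norm x)}. a \<le> norm y"
      by (auto simp: span_singleton mult_right_mono)
  qed (auto simp: span_base)
  moreover have "\<Union>C \<in> P" if "C \<noteq> {}" "subset.chain P C" for C
  proof -
    have CP: "C \<subseteq> P" and ch: "\<And>X Y. X \<in> C \<Longrightarrow> Y \<in> C \<Longrightarrow> X \<subseteq> Y \<or> Y \<subseteq> X"
      using that(2) by (auto simp: subset.chain_def)
    have "subspace (\<Union>C)"
    proof (rule subspaceI)
      show "0 \<in> \<Union>C" using that(1) CP by (auto simp: P_def subspace_def)
    next
      fix u v assume "u \<in> \<Union>C" "v \<in> \<Union>C"
      then obtain X Y where "X \<in> C" "u \<in> X" "Y \<in> C" "v \<in> Y" by auto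
      then obtain Z where "Z \<in> C" "u \<in> Z" "v \<in> Z" using ch by blast
      then show "u + v \<in> \<Union>C" using CP by (auto simp: P_def intro!: bexI[of _ Z] subspace_add)
    next
      fix c and u assume "u \<in> \<Union>C"
      then show "c *\<^sub>R u \<in> \<Union>C" using CP by (fastforce simp: P_def subspace_def)
    qed
    then show ?thesis using that(1) CP unfolding P_def by blast
  qed
  ultimately obtain G where GP: "G \<in> P" and max: "\<And>X. X \<in> P \<Longrightarrow> G \<subseteq> X \<Longrightarrow> X = G"
    using subset_Zorn_nonempty[of P] by (metis empty_iff)
  have sub: "subspace G" and xG: "(x, norm x) \<in> G" and le: "\<And>y a. (y, a) \<in> G \<Longrightarrow> a \<le> norm y"
    using GP by (auto simp: P_def)
  have "\<exists>a. (z, a) \<in> G" for z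
  proof -
    \<comment> \<open>Adding two points of \<open>G\<close> cancels \<open>z\<close>: each lower
      bound that domination imposes on a value at \<open>z\<close> lies below each upper bound. The
      supremum \<open>c\<close> of the lower bounds is then an admissible value.\<close>
    have key: "a - norm (y - z) \<le> norm (y' + z) - a'" if "(y, a) \<in> G" "(y', a') \<in> G" for y a y' a'
    proof -
      have "(y + y', a + a') \<in> G" using subspace_add[OF sub that] by simp
      from le[OF this] have "a + a' \<le> norm ((y - z) + (y' + z))" by simp
      also have "\<dots> \<le> norm (y - z) + norm (y' + z)" by (rule norm_triangle_ineq)
      finally show ?thesis by simp
    qed
    define c where "c = (SUP (y, a)\<in>G. a - norm (y - z))"
    have "bdd_above ((\<lambda>(y, a). a - norm (y - z)) ` G)"
      using key[OF _ xG] by (auto intro!: bdd_aboveI2)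
    then have c1: "a - norm (y - z) \<le> c" if "(y, a) \<in> G" for y a
      unfolding c_def using cSUP_upper[OF that, of "\<lambda>(y, a). a - norm (y - z)"] by simp
    have c2: "c \<le> norm (y + z) - a" if "(y, a) \<in> G" for y a
      unfolding c_def using xG key that by (intro cSUP_least) auto
    define G' where "G' = {u + v |u v. u \<in> G \<and> v \<in> span {(z, c)}}"
    have "subspace G'" unfolding G'_def by (intro subspace_sums sub subspace_span)
    moreover have GG': "G \<subseteq> G'"
    proof
      show "u \<in> G'" if "u \<in> G" for u
        unfolding G'_def using that span_zero[of "{(z, c)}"] by (intro CollectI exI[of _ u] exI[of _ 0]) simp
    qed
    moreover have "b \<le> norm w" if wb: "(w, b) \<in> G'" for w b
    proof -
      obtain y a t where ya: "(y, a) \<in> G" and w: "w = y + t *\<^sub>R z" and b: "b = a + t * c"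
        using wb by (auto simp: G'_def span_singleton)
      \<comment> \<open>By homogeneity the nonzero cases reduce to \<open>t = 1\<close> and
        \<open>t = -1\<close>, where \<open>c2\<close> and \<open>c1\<close> are the required
        inequalities.\<close>
      consider "t = 0" | "t > 0" | "t < 0" by linarith
      then show ?thesis
      proof cases
        case 1
        then show ?thesis using le[OF ya] by (simp add: w b)
      next
        case 2
        have "(y /\<^sub>R t, a / t) \<in> G"
          using subspace_scale[OF sub ya, of "inverse t"] by (simp add: field_simps)
        from c2[OF this] have "t * (a / t + c) \<le> t * norm (y /\<^sub>R t + z)"
          using 2 by simp
        also have "\<dots> = norm (t *\<^sub>R (y /\<^sub>R t + z))" using 2 by simp
        also have "t *\<^sub>R (y /\<^sub>R t + z) = w" using 2 by (simp add: w scaleR_right_distrib)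
        finally show ?thesis using 2 by (simp add: b algebra_simps)
      next
        case 3
        have "(y /\<^sub>R (- t), a / (- t)) \<in> G"
          using subspace_scale[OF sub ya, of "inverse (- t)"] by (simp add: field_simps)
        from c1[OF this] have "(- t) * (a / (- t) - c) \<le> (- t) * norm (y /\<^sub>R (- t) - z)"
          using 3 by (intro mult_left_mono) auto
        also have "\<dots> = norm ((- t) *\<^sub>R (y /\<^sub>R (- t) - z))" using 3 by simp
        also have "(- t) *\<^sub>R (y /\<^sub>R (- t) - z) = w" using 3 by (simp add: w scaleR_right_diff_distrib)
        finally show ?thesis using 3 by (simp add: b algebra_simps)
      qed
    qed
    ultimately have "G' \<in> P" using xG by (auto simp: P_def)
    then have "G' = G" using max GG' by blast
    moreover have "(z, c) \<in> G'"
      unfolding G'_def using subspace_0[OF sub] span_base[of "(z, c)" "{(z, c)}"]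
      by (intro CollectI exI[of _ 0] exI[of _ "(z, c)"]) simp
    ultimately show ?thesis by blast
  qed
  then obtain f where f: "\<And>z. (z, f z) \<in> G" by metis
  \<comment> \<open>The difference \<open>(0, a - b)\<close> and its negative both lie in
    \<open>G\<close>, and domination at 0 makes both second entries at most 0.\<close>
  have uniq: "a = b" if "(y, a) \<in> G" "(y, b) \<in> G" for y a b
    using le[of 0 "a - b"] le[of 0 "b - a"] subspace_diff[OF sub that] subspace_diff[OF sub that(2,1)]
    by simp
  have "linear f"
  proof (rule linearI)
    show "f (a + b) = f a + f b" for a b
      using subspace_add[OF sub f[of a] f[of b]] f[of "a + b"] uniq by simp
    show "f (k *\<^sub>R a) = k *\<^sub>R f a" for k a
      using subspace_scale[OF sub f[of a], of k] f[of "k *\<^sub>R a"] uniq by simp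
  qed
  then show ?thesis using f xG uniq le by blast
qed

lemma support_functionals_norm_le:
  assumes "l \<in> support_functionals x"
  shows "cmod (l y) \<le> norm y"
  using assms onorm[of l y] by (auto simp: support_functionals_def bounded_clinear_def)

text \<open>The real functional \<open>f\<close> is the real part of the complex linear functional
  \<open>f(y) - i f(i y)\<close>; rotating the argument transfers the bound for \<open>f\<close> to
  the modulus of \<open>l\<close>.\<close>

lemma support_functionals_nonempty:
  fixes x :: "'a::complex_normed_vector"
  assumes "x \<noteq> 0"
  obtains l where "l \<in> support_functionals x"
proof -
  obtain f :: "'a \<Rightarrow> real" where lin: "linear f" and fx: "f x = norm x" and le: "\<And>y. f y \<le> norm y"
    using hahn_banach_real by blast
  define l where "l y = Complex (f y) (- f (\<i> *\<^sub>C y))" for y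
  have add: "l (y + z) = l y + l z" for y z
    by (simp add: l_def scaleC_add_right linear_add[OF lin] complex_eq_iff)
  have c_eq: "c *\<^sub>C y = Re c *\<^sub>R y + Im c *\<^sub>R (\<i> *\<^sub>C y)" for c and y :: 'a
  proof -
    have "c = of_real (Re c) + of_real (Im c) * \<i>" by (simp add: complex_eq_iff)
    then show ?thesis by (metis scaleC_add_left scaleC_scaleC scaleR_scaleC)
  qed
  have i2: "\<i> *\<^sub>C (\<i> *\<^sub>C y) = - y" for y :: 'a
    using c_eq[of "-1" y] by (simp add: scaleC_scaleC)
  have scale: "l (c *\<^sub>C y) = c * l y" for c y
    by (simp add: l_def c_eq[of c y] scaleC_add_right scaleC_scaleR i2 linear_add[OF lin]
        linear_scale[OF lin] linear_neg[OF lin] linear_diff[OF lin] complex_eq_iff algebra_simps)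
  have bound: "cmod (l y) \<le> norm y" for y
  proof (cases "l y = 0")
    case False
    \<comment> \<open>This phase turns the value of \<open>l\<close> into its modulus, which is real
      and hence a value of \<open>f\<close>.\<close>
    define c where "c = cnj (l y) / cmod (l y)"
    have c1: "cmod c = 1" using False by (simp add: c_def norm_divide)
    have "l (c *\<^sub>C y) = of_real (cmod (l y))"
      using False unfolding scale c_def
      by (simp add: mult.commute complex_norm_square[symmetric] power2_eq_square)
    then have "cmod (l y) = f (c *\<^sub>C y)" by (simp add: l_def complex_eq_iff)
    also have "\<dots> \<le> norm y" using le[of "c *\<^sub>C y"] by (simp add: norm_scaleC c1)
    finally show ?thesis .
  qed simp
  have "l (c *\<^sub>R y) = c *\<^sub>R l y" for c y
    by (simp add: scaleR_scaleC scale scaleC_complex_def)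
  then have bl: "bounded_linear l"
    using add bound by (intro bounded_linear_intro[where K=1]) auto
  have Re: "Re (l x) = norm x" by (simp add: l_def fx)
  \<comment> \<open>The real part already exhausts the bound \<open>norm x\<close> on the modulus,
    so the imaginary part vanishes.\<close>
  then have lx: "l x = of_real (norm x)"
    using bound[of x] abs_Re_le_cmod[of "l x"] cmod_eq_Re
    by (metis Re abs_norm_cancel cmod_Re_le_iff complex_eq_iff Im_complex_of_real Re_complex_of_real
        cmod_power2 norm_ge_zero order_antisym add_cancel_right_right power2_eq_iff zero_eq_power2)
  have "onorm l \<le> 1" using bound by (intro onorm_bound) auto
  moreover have "1 \<le> onorm l"
    using le_onorm[OF bl, of x] assms by (simp add: lx)
  ultimately show ?thesis
    using that bl scale lx by (auto simp: support_functionals_def bounded_clinear_def scaleC_complex_def)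
qed

subsection \<open>Holomorphic maps between complex Banach spaces\<close>

lemma blinfun_apply_fderiv: "(f has_derivative F) (at x) \<Longrightarrow> blinfun_apply (fderiv f x) = F"
  unfolding fderiv_def
  by (metis bounded_linear_Blinfun_apply frechet_derivative_at has_derivative_bounded_linear)

lemma Hol_has_derivative:
  assumes "f \<in> Hol U" "x \<in> U"
  shows "(f has_derivative blinfun_apply (fderiv f x)) (at x)"
  using assms blinfun_apply_fderiv unfolding Hol_def by fastforce

lemma Hol_bounded_clinear_fderiv:
  assumes "f \<in> Hol U" "x \<in> U"
  shows "bounded_clinear (blinfun_apply (fderiv f x))"
  using assms blinfun_apply_fderiv unfolding Hol_def by fastforce

lemma HolI:
  assumes "\<And>x. x \<in> U \<Longrightarrow> (f has_derivative F x) (at x)"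
    and "\<And>x c v. x \<in> U \<Longrightarrow> F x (c *\<^sub>C v) = c *\<^sub>C F x v"
  shows "f \<in> Hol U"
  using assms has_derivative_bounded_linear unfolding Hol_def bounded_clinear_def by blast

text \<open>Restriction to a complex line followed by a functional reduces questions to one complex
  variable; complex linearity of the derivative is what makes the scalar function
  holomorphic.\<close>

lemma Hol_line_deriv:
  fixes l :: "'b::complex_normed_vector \<Rightarrow> complex"
  assumes f: "f \<in> Hol U" and l: "bounded_clinear l" and U: "a + t *\<^sub>C v \<in> U"
  shows "((\<lambda>t. l (f (a + t *\<^sub>C v))) has_field_derivative
           l (blinfun_apply (fderiv f (a + t *\<^sub>C v)) v)) (at t)"
proof -
  let ?D = "blinfun_apply (fderiv f (a + t *\<^sub>C v))"
  have "((\<lambda>t. a + t *\<^sub>C v) has_derivative (\<lambda>s. s *\<^sub>C v)) (at t)"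
    by (auto intro!: derivative_eq_intros bounded_linear_imp_has_derivative[OF bounded_linear_scaleC_left])
  from has_derivative_compose[OF this Hol_has_derivative[OF f U]]
  have "((\<lambda>t. f (a + t *\<^sub>C v)) has_derivative (\<lambda>s. ?D (s *\<^sub>C v))) (at t)" .
  from bounded_linear.has_derivative[OF bounded_clinear_linear[OF l] this]
  have "((\<lambda>t. l (f (a + t *\<^sub>C v))) has_derivative (\<lambda>s. l (?D (s *\<^sub>C v)))) (at t)" .
  moreover have "(\<lambda>s. l (?D (s *\<^sub>C v))) = (*) (l (?D v))"
    using bounded_clinear_scaleC[OF Hol_bounded_clinear_fderiv[OF f U]] bounded_clinear_scaleC[OF l]
    by (simp add: scaleC_complex_def mult.commute fun_eq_iff)
  ultimately show ?thesis by (simp add: has_field_derivative_def)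
qed

text \<open>A support functional at \<open>z\<close> attains \<open>norm z\<close>. Scalar estimates
  whose constants do not depend on the functional thus become norm estimates.\<close>

lemma norm_le_by_functionals:
  fixes z :: "'b::complex_normed_vector"
  assumes "0 \<le> K"
    and "\<And>l. bounded_clinear l \<Longrightarrow> (\<And>y. cmod (l y) \<le> norm y) \<Longrightarrow> cmod (l z) \<le> K"
  shows "norm z \<le> K"
proof (cases "z = 0")
  case False
  then obtain l where l: "l \<in> support_functionals z" using support_functionals_nonempty by blast
  then have "cmod (l z) \<le> K"
    using assms(2)[of l] support_functionals_norm_le[OF l] by (auto simp: support_functionals_def)
  then show ?thesis using l by (simp add: support_functionals_def)
qed (use assms in simp)

section \<open>Cauchy estimates in normed spaces\<close>

lemma holomorphic_cauchy_remainder: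
  assumes hol: "\<psi> holomorphic_on ball 0 s" and s: "s > 0"
    and M: "\<And>t. t \<in> ball 0 s \<Longrightarrow> cmod (\<psi> t) \<le> M"
  shows "cmod (deriv \<psi> 0) \<le> 2 * M / s"
    and "cmod t \<le> s / 2 \<Longrightarrow> cmod (\<psi> t - \<psi> 0 - deriv \<psi> 0 * t) \<le> 32 * M / s\<^sup>2 * (cmod t)\<^sup>2"
proof -
  \<comment> \<open>Radius \<open>s / 2\<close> at the origin gives the constant
    \<open>2 * M / s\<close>. Radius \<open>s / 4\<close> around points of
    \<open>cball 0 (s / 2)\<close> bounds the second derivative by \<open>2 * M / (s / 4)^2\<close>,
    which is \<open>32 * M / s^2\<close>. The closed discs stay inside the open disc on which
    \<open>M\<close> is a bound.\<close>
  have bd: "cmod ((deriv ^^ n) \<psi> z) \<le> fact n * M / \<rho> ^ n" if "\<rho> > 0" "cball z \<rho> \<subseteq> ball 0 s" for n z \<rho>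
  proof (rule Cauchy_inequality)
    show "\<psi> holomorphic_on ball z \<rho>"
      using holomorphic_on_subset[OF hol] that ball_subset_cball by blast
    show "continuous_on (cball z \<rho>) \<psi>"
      using holomorphic_on_imp_continuous_on[OF hol] continuous_on_subset that by blast
    show "cmod (\<psi> w) \<le> M" if "cmod (z - w) = \<rho>" for w
      using that \<open>cball z \<rho> \<subseteq> ball 0 s\<close> by (intro M) (auto simp: dist_norm subset_iff)
  qed fact
  show "cmod (deriv \<psi> 0) \<le> 2 * M / s"
    using bd[of "s / 2" 0 1] s by (auto simp: field_simps cball_subset_ball_iff)
  assume t: "cmod t \<le> s / 2"
  have "cmod ((deriv ^^ 0) \<psi> t - (\<Sum>i\<le>1. (deriv ^^ i) \<psi> 0 * (t - 0) ^ i / fact i))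
      \<le> (32 * M / s\<^sup>2) * cmod (t - 0) ^ Suc 1 / fact 1"
  proof (rule complex_Taylor[where S = "cball 0 (s / 2)" and f = "\<lambda>i. (deriv ^^ i) \<psi>"])
    show "((deriv ^^ i) \<psi> has_field_derivative (deriv ^^ Suc i) \<psi> x) (at x within cball 0 (s / 2))"
      if "x \<in> cball 0 (s / 2)" for i x
      using has_field_derivative_higher_deriv[OF hol open_ball, of x i] that s
      by (auto intro: has_field_derivative_at_within)
    show "cmod ((deriv ^^ Suc 1) \<psi> x) \<le> 32 * M / s\<^sup>2" if x: "x \<in> cball 0 (s / 2)" for x
    proof -
      have "cball x (s / 4) \<subseteq> ball 0 s"
      proof
        fix w assume "w \<in> cball x (s / 4)"
        then show "w \<in> ball 0 s"
          using x s norm_triangle_ineq[of x "w - x"] by (simp add: dist_norm norm_minus_commute)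
      qed
      from bd[OF _ this, of 2] show ?thesis
        using s by (simp add: power_divide numeral_2_eq_2 field_simps)
    qed
  qed (use t s in auto)
  then show "cmod (\<psi> t - \<psi> 0 - deriv \<psi> 0 * t) \<le> 32 * M / s\<^sup>2 * (cmod t)\<^sup>2"
    by (simp add: power2_eq_square algebra_simps)
qed

context
  fixes f :: "'a::complex_normed_vector \<Rightarrow> 'b::complex_normed_vector" and U x R M
  assumes f: "f \<in> Hol U" and U: "ball x R \<subseteq> U" and R: "R > 0"
    and M: "\<And>y. y \<in> ball x R \<Longrightarrow> norm (f y) \<le> M"
begin

lemma Hol_line_estimates:
  assumes v: "v \<noteq> 0" and l: "bounded_clinear l" "\<And>y. cmod (l y) \<le> norm y"
  shows "cmod (l (blinfun_apply (fderiv f x) v)) \<le> 2 * M / R * norm v"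
    and "norm v \<le> R / 2 \<Longrightarrow>
      cmod (l (f (x + v) - f x - blinfun_apply (fderiv f x) v)) \<le> 32 * M / R\<^sup>2 * (norm v)\<^sup>2"
proof -
  define \<psi> where "\<psi> t = l (f (x + t *\<^sub>C v))" for t
  \<comment> \<open>The point \<open>x + t v\<close> lies in \<open>ball x R\<close> exactly for
    \<open>cmod t < s\<close>.\<close>
  define s where "s = R / norm v"
  have s: "s > 0" using v R by (simp add: s_def)
  have inU: "x + t *\<^sub>C v \<in> ball x R" if "t \<in> ball 0 s" for t
    using that v by (simp add: s_def dist_norm norm_scaleC field_simps)
  have der: "(\<psi> has_field_derivative l (blinfun_apply (fderiv f (x + t *\<^sub>C v)) v)) (at t)"
    if "t \<in> ball 0 s" for t
    unfolding \<psi>_def using inU[OF that] U by (intro Hol_line_deriv[OF f l(1)]) auto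
  then have hol: "\<psi> holomorphic_on ball 0 s"
    using s by (meson holomorphic_onI field_differentiable_at_within field_differentiable_def)
  have bd: "cmod (\<psi> t) \<le> M" if "t \<in> ball 0 s" for t
    unfolding \<psi>_def using l(2) M[OF inU[OF that]] order_trans by blast
  have d0: "deriv \<psi> 0 = l (blinfun_apply (fderiv f x) v)"
    using DERIV_imp_deriv[OF der[of 0]] s by simp
  show "cmod (l (blinfun_apply (fderiv f x) v)) \<le> 2 * M / R * norm v"
    using holomorphic_cauchy_remainder(1)[OF hol s bd] v by (simp add: d0 s_def)
  assume "norm v \<le> R / 2"
  \<comment> \<open>The increment \<open>v\<close> corresponds to the parameter
    \<open>t = 1\<close>, and the condition on \<open>norm v\<close> puts it in the half disc where
    the remainder estimate holds.\<close>
  then have "cmod 1 \<le> s / 2" using v by (simp add: s_def field_simps)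
  from holomorphic_cauchy_remainder(2)[OF hol s bd this]
  have "cmod (\<psi> 1 - \<psi> 0 - deriv \<psi> 0) \<le> 32 * M / R\<^sup>2 * (norm v)\<^sup>2"
    using v by (simp add: s_def power_divide field_simps)
  then show "cmod (l (f (x + v) - f x - blinfun_apply (fderiv f x) v)) \<le> 32 * M / R\<^sup>2 * (norm v)\<^sup>2"
    using bounded_clinear_linear[OF l(1)] unfolding d0
    by (simp add: \<psi>_def linear_simps)
qed

lemma Hol_cauchy_bound_nonneg: "0 \<le> M"
  using M[of x] R norm_ge_zero[of "f x"] by (metis centre_in_ball order_trans)

lemma Hol_cauchy_estimate: "norm (blinfun_apply (fderiv f x) v) \<le> 2 * M / R * norm v"
proof (cases "v = 0")
  case False
  show ?thesis
  proof (rule norm_le_by_functionals)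
    show "0 \<le> 2 * M / R * norm v" using Hol_cauchy_bound_nonneg R by simp
  qed (rule Hol_line_estimates(1)[OF False])
qed (simp add: blinfun.zero_right)

lemma Hol_taylor_remainder:
  assumes "norm v \<le> R / 2"
  shows "norm (f (x + v) - f x - blinfun_apply (fderiv f x) v) \<le> 32 * M / R\<^sup>2 * (norm v)\<^sup>2"
proof (cases "v = 0")
  case False
  show ?thesis
  proof (rule norm_le_by_functionals)
    show "0 \<le> 32 * M / R\<^sup>2 * (norm v)\<^sup>2" using Hol_cauchy_bound_nonneg R by simp
  qed (rule Hol_line_estimates(2)[OF False _ _ assms])
qed (simp add: blinfun.zero_right)

end

section \<open>Uniform limits and directional derivatives of holomorphic maps\<close>

lemma Hol_diff:
  assumes "f \<in> Hol U" "g \<in> Hol U" shows "(\<lambda>x. f x - g x) \<in> Hol U"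
    and "x \<in> U \<Longrightarrow> fderiv (\<lambda>x. f x - g x) x = fderiv f x - fderiv g x"
proof -
  have der: "((\<lambda>x. f x - g x) has_derivative blinfun_apply (fderiv f x - fderiv g x)) (at x)"
    if "x \<in> U" for x
    using has_derivative_diff[OF Hol_has_derivative[OF assms(1) that] Hol_has_derivative[OF assms(2) that]]
    by (simp add: blinfun.diff_left[symmetric])
  show "(\<lambda>x. f x - g x) \<in> Hol U"
    using bounded_clinear_scaleC[OF Hol_bounded_clinear_fderiv[OF assms(1)]]
      bounded_clinear_scaleC[OF Hol_bounded_clinear_fderiv[OF assms(2)]]
    by (intro HolI[OF der]) (auto simp: blinfun.diff_left scaleC_diff_right)
  show "fderiv (\<lambda>x. f x - g x) x = fderiv f x - fderiv g x" if "x \<in> U"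
    using blinfun_apply_fderiv[OF der[OF that]] by (simp add: blinfun_apply_inject)
qed

text \<open>The Cauchy estimate for \<open>f n - f m\<close> on balls of radius \<open>R\<close>
  makes the derivatives a Cauchy sequence in operator norm, uniformly in \<open>x\<close>; halving
  the radius leaves room for those balls. The limit of the derivatives is then the derivative of the
  limit.\<close>

lemma Hol_uniform_limit:
  fixes f :: "nat \<Rightarrow> 'a::complex_normed_vector \<Rightarrow> 'b::complex_banach"
  assumes f: "\<And>n. f n \<in> Hol U" and U: "ball a (2 * R) \<subseteq> U" and R: "R > 0"
    and conv: "\<And>n y. y \<in> ball a (2 * R) \<Longrightarrow> norm (f n y - g y) \<le> \<epsilon> n"
    and \<epsilon>: "\<epsilon> \<longlonglongrightarrow> 0"
  shows "g \<in> Hol (ball a R)"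
    and "x \<in> ball a R \<Longrightarrow> (\<lambda>n. fderiv (f n) x) \<longlonglongrightarrow> fderiv g x"
proof -
  have le: "norm (fderiv (f n) x - fderiv (f m) x) \<le> 2 / R * (\<epsilon> n + \<epsilon> m)"
    if x: "x \<in> ball a R" for n m x
  proof -
    have sub: "ball x R \<subseteq> ball a (2 * R)"
      using x by (auto simp: subset_iff intro: dist_triangle_lt[THEN le_less_trans[rotated]])
        (smt (verit) dist_commute dist_triangle)
    have "norm (f n y - f m y) \<le> \<epsilon> n + \<epsilon> m" if "y \<in> ball x R" for y
      using norm_triangle_ineq4[of "f n y - g y" "f m y - g y"] conv[of y n] conv[of y m] sub that by auto
    from Hol_cauchy_estimate[OF Hol_diff(1)[OF f f] _ R this]
    have "norm (blinfun_apply (fderiv (f n) x - fderiv (f m) x) v) \<le> 2 * (\<epsilon> n + \<epsilon> m) / R * norm v" for v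
      using Hol_diff(2)[OF f f, of x n m] x sub U R by (metis centre_in_ball order_trans subsetD)
    moreover have "0 \<le> \<epsilon> k" for k
      using conv[of a k] R by (smt (verit) centre_in_ball norm_ge_zero)
    ultimately show ?thesis
      using R by (intro norm_blinfun_bound) auto
  qed
  have "convergent (\<lambda>n. fderiv (f n) x)" if x: "x \<in> ball a R" for x
  proof (rule Cauchy_convergent, rule metric_CauchyI)
    fix e :: real assume e: "e > 0"
    have "\<forall>\<^sub>F n in sequentially. \<epsilon> n < e * R / 4"
      using order_tendstoD(2)[OF \<epsilon>, of "e * R / 4"] e R by simp
    then obtain N where N: "\<And>n. n \<ge> N \<Longrightarrow> \<epsilon> n < e * R / 4"
      by (auto simp: eventually_sequentially)
    show "\<exists>N. \<forall>m\<ge>N. \<forall>n\<ge>N. dist (fderiv (f m) x) (fderiv (f n) x) < e"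
    proof (intro exI allI impI)
      fix m n assume "m \<ge> N" "n \<ge> N"
      then have "\<epsilon> m + \<epsilon> n < e * R / 2" using N[of m] N[of n] by simp
      then have "2 / R * (\<epsilon> m + \<epsilon> n) < e" using R by (simp add: field_simps)
      then show "dist (fderiv (f m) x) (fderiv (f n) x) < e"
        using le[OF x, of m n] by (simp add: dist_norm)
    qed
  qed
  then obtain L where L: "\<And>x. x \<in> ball a R \<Longrightarrow> (\<lambda>n. fderiv (f n) x) \<longlonglongrightarrow> L x"
    unfolding convergent_def by metis
  \<comment> \<open>Letting \<open>m\<close> tend to infinity in \<open>le\<close> leaves a bound
    independent of \<open>x\<close>, hence uniform convergence of the derivatives.\<close>
  have Lle: "norm (fderiv (f n) x - L x) \<le> 2 / R * \<epsilon> n" if x: "x \<in> ball a R" for n x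
  proof (rule LIMSEQ_le)
    show "(\<lambda>m. norm (fderiv (f n) x - fderiv (f m) x)) \<longlonglongrightarrow> norm (fderiv (f n) x - L x)"
      by (intro tendsto_intros L x)
    show "(\<lambda>m. 2 / R * (\<epsilon> n + \<epsilon> m)) \<longlonglongrightarrow> 2 / R * \<epsilon> n"
      using tendsto_mult[OF tendsto_const tendsto_add[OF tendsto_const \<epsilon>], of "2 / R" "\<epsilon> n"]
      by simp
  qed (use le[OF x] in blast)
  have flim: "(\<lambda>n. f n y) \<longlonglongrightarrow> g y" if "y \<in> ball a (2 * R)" for y
    using Lim_null_comparison[OF always_eventually \<epsilon>, of "\<lambda>n. f n y - g y"] conv[OF that]
    by (simp add: LIM_zero_iff)
  have sub: "ball a R \<subseteq> ball a (2 * R)" using R by auto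
  have "\<exists>g2. \<forall>x\<in>ball a R. (\<lambda>n. f n x) \<longlonglongrightarrow> g2 x \<and> (g2 has_derivative blinfun_apply (L x)) (at x within ball a R)"
  proof (rule has_derivative_sequence)
    show "(f n has_derivative blinfun_apply (fderiv (f n) x)) (at x within ball a R)" if "x \<in> ball a R" for n x
      using Hol_has_derivative[OF f] that U sub by (meson has_derivative_at_withinI subsetD)
    show "\<forall>\<^sub>F n in sequentially. \<forall>x\<in>ball a R. \<forall>h.
        norm (blinfun_apply (fderiv (f n) x) h - blinfun_apply (L x) h) \<le> e * norm h" if "e > 0" for e
    proof -
      have "\<forall>\<^sub>F n in sequentially. \<epsilon> n < e * R / 2"
        using order_tendstoD(2)[OF \<epsilon>, of "e * R / 2"] that R by simp
      then show ?thesis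
      proof eventually_elim
        case (elim n)
        then have *: "2 / R * \<epsilon> n \<le> e" using R by (simp add: field_simps)
        show ?case
        proof (intro ballI allI)
          fix x h assume "x \<in> ball a R"
          then have "norm (fderiv (f n) x - L x) \<le> e" using Lle * order_trans by blast
          then show "norm (blinfun_apply (fderiv (f n) x) h - blinfun_apply (L x) h) \<le> e * norm h"
            using norm_blinfun[of "fderiv (f n) x - L x" h] mult_right_mono[of _ e "norm h"]
            unfolding blinfun.diff_left by (meson norm_ge_zero order_trans)
        qed
      qed
    qed
  qed (use flim[of a] R in auto)
  then obtain g2 where g2: "\<And>x. x \<in> ball a R \<Longrightarrow> (\<lambda>n. f n x) \<longlonglongrightarrow> g2 x"
    "\<And>x. x \<in> ball a R \<Longrightarrow> (g2 has_derivative blinfun_apply (L x)) (at x within ball a R)" by blast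
  have der: "(g has_derivative blinfun_apply (L x)) (at x)" if x: "x \<in> ball a R" for x
  proof -
    have "(g has_derivative blinfun_apply (L x)) (at x within ball a R)"
      using g2(2)[OF x] x
    proof (rule has_derivative_transform[rotated 2])
      show "g y = g2 y" if "y \<in> ball a R" for y
        using LIMSEQ_unique[OF flim g2(1)] that sub by blast
    qed
    then show ?thesis by (simp only: at_within_open[OF x open_ball])
  qed
  show "g \<in> Hol (ball a R)"
  proof (rule HolI[OF der])
    fix x c v assume x: "x \<in> ball a R"
    have lim: "(\<lambda>n. blinfun_apply (fderiv (f n) x) v) \<longlonglongrightarrow> blinfun_apply (L x) v" for v
      by (intro tendsto_intros L x)
    have "(\<lambda>n. c *\<^sub>C blinfun_apply (fderiv (f n) x) v) \<longlonglongrightarrow> c *\<^sub>C blinfun_apply (L x) v"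
      by (intro bounded_linear.tendsto[OF bounded_linear_scaleC_right] lim)
    moreover have "c *\<^sub>C blinfun_apply (fderiv (f n) x) v = blinfun_apply (fderiv (f n) x) (c *\<^sub>C v)" for n
      using bounded_clinear_scaleC[OF Hol_bounded_clinear_fderiv[OF f]] x U sub by fastforce
    ultimately show "blinfun_apply (L x) (c *\<^sub>C v) = c *\<^sub>C blinfun_apply (L x) v"
      using LIMSEQ_unique[OF lim[of "c *\<^sub>C v"]] by simp
  qed
  show "(\<lambda>n. fderiv (f n) x) \<longlonglongrightarrow> fderiv g x" if "x \<in> ball a R"
    using L[OF that] blinfun_apply_fderiv[OF der[OF that]] by (simp add: blinfun_apply_inject)
qed

lemma has_derivative_sequentially:
  assumes der: "(f has_derivative F) (at x)" and s: "s \<longlonglongrightarrow> 0" "\<And>n. s n \<noteq> 0"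
  shows "(\<lambda>n. (f (x + s n *\<^sub>R v) - f x) /\<^sub>R s n) \<longlonglongrightarrow> F v"
proof -
  have "((\<lambda>t. f (x + t *\<^sub>R v)) has_derivative (\<lambda>t. F (t *\<^sub>R v))) (at 0)"
    by (rule has_derivative_compose[of "\<lambda>t. x + t *\<^sub>R v"]) (auto intro!: derivative_eq_intros der)
  then have "((\<lambda>t. f (x + t *\<^sub>R v)) has_vector_derivative F v) (at 0)"
    unfolding has_vector_derivative_def
    using linear_simps(5)[OF has_derivative_bounded_linear[OF der]] by simp
  then have "((\<lambda>t. (f (x + t *\<^sub>R v) - f x) /\<^sub>R t) \<longlongrightarrow> F v) (at 0)"
  proof -
    let ?q = "\<lambda>t. (f (x + t *\<^sub>R v) - f x) /\<^sub>R t - F v"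
    assume "((\<lambda>t. f (x + t *\<^sub>R v)) has_vector_derivative F v) (at 0)"
    then have "((\<lambda>t. norm (f (x + t *\<^sub>R v) - f x - t *\<^sub>R F v) / norm t) \<longlongrightarrow> 0) (at 0)"
      by (simp add: has_vector_derivative_def has_derivative_at)
    moreover have "\<forall>\<^sub>F t in at 0. norm (f (x + t *\<^sub>R v) - f x - t *\<^sub>R F v) / norm t = norm (?q t)"
    proof (rule eventually_at_filter[THEN iffD2], rule always_eventually, intro allI impI)
      fix t :: real assume "t \<noteq> 0"
      then have "?q t = (f (x + t *\<^sub>R v) - f x - t *\<^sub>R F v) /\<^sub>R t"
        by (simp add: scaleR_right_diff_distrib)
      then show "norm (f (x + t *\<^sub>R v) - f x - t *\<^sub>R F v) / norm t = norm (?q t)"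
        by (simp add: divide_inverse_commute)
    qed
    ultimately have "((\<lambda>t. norm (?q t)) \<longlongrightarrow> 0) (at 0)"
      by (rule Lim_transform_eventually)
    then show ?thesis by (simp only: tendsto_norm_zero_iff LIM_zero_iff)
  qed
  moreover have "filterlim s (at 0) sequentially"
    using s by (simp add: filterlim_at)
  ultimately show ?thesis by (rule filterlim_compose)
qed

text \<open>The difference quotients of \<open>f\<close> in direction \<open>v\<close> are
  holomorphic and converge uniformly to the directional derivative, so
  \<open>Hol_uniform_limit\<close> applies. Their derivatives in direction \<open>u\<close> are
  difference quotients, in direction \<open>v\<close>, of the derivative of \<open>f\<close> along
  \<open>u\<close>; one sequence with two descriptions of its limit yields the symmetry.\<close>

lemma Hol_directional_fderiv:
  fixes f :: "'a::complex_normed_vector \<Rightarrow> 'b::complex_banach"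
  assumes f: "f \<in> Hol U" and U: "ball a (4 * R) \<subseteq> U" and R: "R > 0"
    and M: "\<And>y. y \<in> ball a (4 * R) \<Longrightarrow> norm (f y) \<le> M"
  shows "(\<lambda>x. blinfun_apply (fderiv f x) v) \<in> Hol (ball a R)" (is ?H)
    and "x \<in> ball a R \<Longrightarrow> fderiv (\<lambda>x. blinfun_apply (fderiv f x) v) x u =
           fderiv (\<lambda>x. blinfun_apply (fderiv f x) u) x v"
proof -
  \<comment> \<open>Positive step sizes tending to 0 that move a point by at most \<open>R\<close>,
    so that translates of points in the ball of radius \<open>2 * R\<close> stay in the ball of
    radius \<open>4 * R\<close>. The summand 1 next to \<open>norm v\<close> covers
    \<open>v = 0\<close>.\<close>
  define s where "s v n = R / ((norm v + 1) * (real n + 1))" for v :: 'a and n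
  have s_pos: "s v n > 0" for v n using R by (simp add: s_def add_nonneg_pos)
  have s_lim: "s v \<longlonglongrightarrow> 0" for v
  proof -
    have "(\<lambda>n. R / (norm v + 1) * (1 / real (Suc n))) \<longlonglongrightarrow> R / (norm v + 1) * 0"
      by (intro tendsto_intros lim_1_over_n[THEN LIMSEQ_Suc])
    then show ?thesis by (simp add: s_def[abs_def] field_simps)
  qed
  have s_norm: "norm (s v n *\<^sub>R v) \<le> R" for v n
  proof -
    have "norm v \<le> (norm v + 1) * (real n + 1)"
      by (simp add: distrib_left distrib_right)
    then show ?thesis
      using R s_pos[of v n] by (simp add: s_def divide_le_eq mult_left_mono add_nonneg_pos)
  qed
  define F where "F v n y = (f (y + s v n *\<^sub>R v) - f y) /\<^sub>R s v n" for v n y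
  have sub: "y + s v n *\<^sub>R v \<in> ball a (4 * R)" if "y \<in> ball a (2 * R)" for v n y
  proof -
    have "dist a (y + s v n *\<^sub>R v) \<le> dist a y + norm (s v n *\<^sub>R v)"
      using norm_triangle_ineq4[of "a - y" "s v n *\<^sub>R v"] by (simp add: dist_norm algebra_simps)
    then show ?thesis using that s_norm[of v n] R by simp
  qed
  have der: "(F v n has_derivative
      (\<lambda>u. (blinfun_apply (fderiv f (y + s v n *\<^sub>R v)) u - blinfun_apply (fderiv f y) u) /\<^sub>R s v n)) (at y)"
    if y: "y \<in> ball a (2 * R)" for v n y
  proof -
    have "(f has_derivative blinfun_apply (fderiv f y)) (at y)"
      using y R by (intro Hol_has_derivative[OF f] subsetD[OF U]) simp
    moreover have "((\<lambda>y. f (y + s v n *\<^sub>R v)) has_derivative blinfun_apply (fderiv f (y + s v n *\<^sub>R v))) (at y)"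
      by (rule has_derivative_compose[of "\<lambda>y. y + s v n *\<^sub>R v" "\<lambda>u. u"])
        (auto intro!: derivative_eq_intros Hol_has_derivative[OF f] subsetD[OF U sub[OF y]])
    ultimately show ?thesis unfolding F_def by (auto intro!: derivative_eq_intros)
  qed
  have HolF: "F v n \<in> Hol (ball a (2 * R))" for v n
  proof (rule HolI[OF der])
    fix y c u assume y: "y \<in> ball a (2 * R)"
    have "y \<in> ball a (4 * R)" using y R by simp
    then have "y \<in> U" "y + s v n *\<^sub>R v \<in> U" using sub[OF y] U by blast+
    then show "(blinfun_apply (fderiv f (y + s v n *\<^sub>R v)) (c *\<^sub>C u) - blinfun_apply (fderiv f y) (c *\<^sub>C u)) /\<^sub>R s v n =
        c *\<^sub>C ((blinfun_apply (fderiv f (y + s v n *\<^sub>R v)) u - blinfun_apply (fderiv f y) u) /\<^sub>R s v n)"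
      by (simp add: bounded_clinear_scaleC[OF Hol_bounded_clinear_fderiv[OF f]] scaleC_scaleR scaleC_diff_right)
  qed
  \<comment> \<open>Taylor remainder with radius \<open>2 * R\<close>: it is quadratic in the step,
    so one factor \<open>s v n\<close> survives the division.\<close>
  have err: "norm (F v n y - blinfun_apply (fderiv f y) v) \<le> 8 * M / R\<^sup>2 * (norm v)\<^sup>2 * s v n"
    if y: "y \<in> ball a (2 * R)" for v n y
  proof -
    have ysub: "ball y (2 * R) \<subseteq> ball a (4 * R)"
    proof
      fix z assume "z \<in> ball y (2 * R)"
      then show "z \<in> ball a (4 * R)" using y dist_triangle[of a z y] by simp
    qed
    have "F v n y - blinfun_apply (fderiv f y) v =
        (f (y + s v n *\<^sub>R v) - f y - blinfun_apply (fderiv f y) (s v n *\<^sub>R v)) /\<^sub>R s v n"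
      using s_pos[of v n] by (simp add: F_def blinfun.scaleR_right scaleR_right_diff_distrib)
    also have "norm \<dots> = norm (f (y + s v n *\<^sub>R v) - f y - blinfun_apply (fderiv f y) (s v n *\<^sub>R v)) / s v n"
      using s_pos[of v n] by (simp add: divide_inverse_commute)
    also have "\<dots> \<le> (32 * M / (2 * R)\<^sup>2 * (norm (s v n *\<^sub>R v))\<^sup>2) / s v n"
    proof (rule divide_right_mono)
      show "norm (f (y + s v n *\<^sub>R v) - f y - blinfun_apply (fderiv f y) (s v n *\<^sub>R v))
          \<le> 32 * M / (2 * R)\<^sup>2 * (norm (s v n *\<^sub>R v))\<^sup>2"
        using R s_norm[of v n]
        by (intro Hol_taylor_remainder[OF f subset_trans[OF ysub U] _ M[OF subsetD[OF ysub]]]) simp_all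
    qed (use s_pos[of v n] in simp)
    also have "\<dots> = 8 * M / R\<^sup>2 * (norm v)\<^sup>2 * s v n"
      using s_pos[of v n] R by (simp add: power_mult_distrib power2_eq_square field_simps)
    finally show ?thesis .
  qed
  have err_lim: "(\<lambda>n. 8 * M / R\<^sup>2 * (norm v)\<^sup>2 * s v n) \<longlonglongrightarrow> 0" for v
    using tendsto_mult_right_zero[OF s_lim] by blast
  note lim = Hol_uniform_limit[OF HolF order_refl R err err_lim]
  show HG: "(\<lambda>x. blinfun_apply (fderiv f x) v) \<in> Hol (ball a R)" for v
    by (rule lim(1))
  assume x: "x \<in> ball a R"
  then have x2: "x \<in> ball a (2 * R)" using R by simp
  have "(\<lambda>n. blinfun_apply (fderiv (F v n) x) u) \<longlonglongrightarrow> blinfun_apply (fderiv (\<lambda>x. blinfun_apply (fderiv f x) v) x) u"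
    by (intro tendsto_intros lim(2) x)
  moreover have "blinfun_apply (fderiv (F v n) x) u =
     (blinfun_apply (fderiv f (x + s v n *\<^sub>R v)) u - blinfun_apply (fderiv f x) u) /\<^sub>R s v n" for n
    by (simp add: blinfun_apply_fderiv[OF der[OF x2]])
  moreover have "(\<lambda>n. (blinfun_apply (fderiv f (x + s v n *\<^sub>R v)) u - blinfun_apply (fderiv f x) u) /\<^sub>R s v n)
     \<longlonglongrightarrow> blinfun_apply (fderiv (\<lambda>x. blinfun_apply (fderiv f x) u) x) v"
    using s_pos by (intro has_derivative_sequentially Hol_has_derivative[OF HG x] s_lim) (metis less_irrefl)
  ultimately show "fderiv (\<lambda>x. blinfun_apply (fderiv f x) v) x u =
           fderiv (\<lambda>x. blinfun_apply (fderiv f x) u) x v"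
    using LIMSEQ_unique by fastforce
qed

section \<open>The derivative as a holomorphic operator-valued map\<close>

lemma Hol_locally_bounded:
  assumes f: "f \<in> Hol U" and U: "open U" "x \<in> U"
  obtains R M where "R > 0" "ball x (4 * R) \<subseteq> U" "\<And>y. y \<in> ball x (4 * R) \<Longrightarrow> norm (f y) \<le> M"
proof -
  have "isCont f x" using Hol_has_derivative[OF f U(2)] has_derivative_continuous by blast
  then obtain d where d: "d > 0" "\<And>y. dist y x < d \<Longrightarrow> dist (f y) (f x) < 1"
    unfolding continuous_at_eps_delta by (metis zero_less_one)
  obtain e where e: "e > 0" "ball x e \<subseteq> U" using U openE by blast
  show ?thesis
  proof (rule that[of "min d e / 4" "norm (f x) + 1"])
    show "norm (f y) \<le> norm (f x) + 1" if "y \<in> ball x (4 * (min d e / 4))" for y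
      using d(2)[of y] that norm_triangle_ineq2[of "f y" "f x"] by (simp add: dist_norm norm_minus_commute)
  qed (use d e in auto)
qed

text \<open>Directional derivatives give \<open>L u\<close> one vector at a time. Linearity in
  \<open>u\<close> comes from the symmetry, and the estimates are linear in \<open>norm v\<close>,
  which turns pointwise differentiability into differentiability in operator norm.\<close>

lemma Hol_second_derivative:
  fixes f :: "'a::complex_normed_vector \<Rightarrow> 'b::complex_banach"
  assumes f: "f \<in> Hol U" and U: "open U" "a \<in> U"
  obtains L where "(fderiv f has_derivative L) (at a)" "\<And>c u. L (c *\<^sub>C u) = c *\<^sub>C L u"
    "\<And>u v. blinfun_apply (L u) v = blinfun_apply (L v) u"
proof -
  obtain R M where R: "R > 0" and sub: "ball a (4 * R) \<subseteq> U"
    and M: "\<And>y. y \<in> ball a (4 * R) \<Longrightarrow> norm (f y) \<le> M"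
    using Hol_locally_bounded[OF f U] by metis
  define G where "G v x = blinfun_apply (fderiv f x) v" for v x
  note dir = Hol_directional_fderiv[OF f sub R]
  have HG: "G v \<in> Hol (ball a R)" for v using dir(1)[OF M, of v] by (simp add: G_def[abs_def])
  have a: "a \<in> ball a R" using R by simp
  define L where "L u = fderiv (G u) a" for u
  have symm: "blinfun_apply (L u) v = blinfun_apply (L v) u" for u v
    using dir(2)[OF M a, of u v] by (simp add: L_def G_def[abs_def])
  have M0: "0 \<le> M" using M[of a] R norm_ge_zero[of "f a"] by (meson centre_in_ball mult_pos_pos order_trans zero_less_numeral)
  have Gbound: "norm (G v y) \<le> M / R * norm v" if y: "y \<in> ball a R" for v y
  proof -
    have ysub: "ball y (2 * R) \<subseteq> ball a (4 * R)"
    proof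
      fix z assume "z \<in> ball y (2 * R)"
      then show "z \<in> ball a (4 * R)" using y R dist_triangle[of a z y] by simp
    qed
    show ?thesis
      using Hol_cauchy_estimate[OF f subset_trans[OF ysub sub], of M v] R M ysub
      by (simp add: subset_iff G_def)
  qed
  have Lbound: "norm (L u) \<le> norm u * (2 * M / R\<^sup>2)" for u
  proof (rule norm_blinfun_bound)
    show "norm (blinfun_apply (L u) v) \<le> norm u * (2 * M / R\<^sup>2) * norm v" for v
      using Hol_cauchy_estimate[OF HG order_refl R Gbound, of u v]
      by (simp add: L_def power2_eq_square field_simps)
  qed (use M0 in simp)
  have bl: "bounded_linear L"
  proof (rule bounded_linear_intro[OF _ _ Lbound])
    \<comment> \<open>Symmetry moves the sum into the second argument, where each \<open>L w\<close>
      is linear as an operator.\<close>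
    show "L (u + v) = L u + L v" for u v
      by (rule blinfun_eqI) (simp add: blinfun.add_left symm[of "u + v"] blinfun.add_right symm[of _ u] symm[of _ v])
    show "L (r *\<^sub>R u) = r *\<^sub>R L u" for r u
      by (rule blinfun_eqI) (simp add: blinfun.scaleR_left symm[of "r *\<^sub>R u"] blinfun.scaleR_right symm[of _ u])
  qed
  \<comment> \<open>Taylor remainder for \<open>G v\<close>, whose bound
    \<open>M / R * norm v\<close> supplies the factor \<open>norm v\<close> required for the
    operator norm.\<close>
  have rem: "norm (fderiv f (a + u) - fderiv f a - L u) \<le> 32 * M / R ^ 3 * (norm u)\<^sup>2"
    if u: "norm u \<le> R / 2" for u
  proof (rule norm_blinfun_bound)
    show "norm (blinfun_apply (fderiv f (a + u) - fderiv f a - L u) v)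
        \<le> 32 * M / R ^ 3 * (norm u)\<^sup>2 * norm v" for v
      using Hol_taylor_remainder[OF HG order_refl R Gbound u, of v]
      by (simp add: blinfun.diff_left symm[of u v])
        (simp add: L_def G_def power2_eq_square power3_eq_cube field_simps)
  qed (use M0 R in simp)
  have "(fderiv f has_derivative L) (at a)"
  proof (rule has_derivativeI_sandwich[OF _ bl])
    show "R / 2 > 0" using R by simp
    show "norm (fderiv f y - fderiv f a - L (y - a)) / norm (y - a) \<le> 32 * M / R ^ 3 * norm (y - a)"
      if "y \<in> UNIV" "y \<noteq> a" "dist y a < R / 2" for y
      using rem[of "y - a"] that by (simp add: dist_norm divide_le_eq power2_eq_square mult.assoc)
    have "isCont (\<lambda>y. 32 * M / R ^ 3 * norm (y - a)) a" by (intro continuous_intros)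
    then show "((\<lambda>y. 32 * M / R ^ 3 * norm (y - a)) \<longlongrightarrow> 0) (at a)" by (simp add: isCont_def)
  qed
  moreover have "L (c *\<^sub>C u) = c *\<^sub>C L u" for c u
  proof (rule blinfun_eqI)
    have "blinfun_apply (L v) (c *\<^sub>C u) = c *\<^sub>C blinfun_apply (L v) u" for v
      unfolding L_def by (rule bounded_clinear_scaleC[OF Hol_bounded_clinear_fderiv[OF HG a]])
    then show "blinfun_apply (L (c *\<^sub>C u)) v = blinfun_apply (c *\<^sub>C L u) v" for v
      by (simp add: blinfun_apply_scaleC symm[of _ v])
  qed
  ultimately show ?thesis using that symm by blast
qed

lemma Hol_fderiv:
  fixes f :: "'a::complex_normed_vector \<Rightarrow> 'b::complex_banach"
  assumes "f \<in> Hol U" "open U"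
  shows "fderiv f \<in> Hol U"
  unfolding Hol_def bounded_clinear_def
proof safe
  fix x assume "x \<in> U"
  from Hol_second_derivative[OF assms this] obtain L where L: "(fderiv f has_derivative L) (at x)" "\<And>c u. L (c *\<^sub>C u) = c *\<^sub>C L u"
    by metis
  then show "\<exists>F. (bounded_linear F \<and> (\<forall>c x. F (c *\<^sub>C x) = c *\<^sub>C F x)) \<and> (fderiv f has_derivative F) (at x)"
    using has_derivative_bounded_linear by blast
qed

lemma fderiv_fderiv_symmetric:
  fixes f :: "'a::complex_normed_vector \<Rightarrow> 'b::complex_banach"
  assumes "f \<in> Hol U" "open U" "x \<in> U"
  shows "blinfun_apply (blinfun_apply (fderiv (fderiv f) x) u) v =
         blinfun_apply (blinfun_apply (fderiv (fderiv f) x) v) u"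
proof -
  from Hol_second_derivative[OF assms] obtain L where L: "(fderiv f has_derivative L) (at x)"
    "\<And>u v. blinfun_apply (L u) v = blinfun_apply (L v) u"
    by metis
  then show ?thesis by (simp add: blinfun_apply_fderiv[OF L(1)])
qed

subsection \<open>The resolvent near the origin\<close>

text \<open>The equation \<open>T y + S y = z\<close> is solved by a fixed point of
  \<open>inv T (z - S y)\<close>, a contraction in \<open>y\<close> with constant
  \<open>b * s\<close>.\<close>

lemma surj_perturbation:
  fixes T S :: "'a::banach \<Rightarrow> 'a"
  assumes T: "linear T" "surj T" "\<And>y. norm y \<le> b * norm (T y)"
    and S: "linear S" "\<And>y. norm (S y) \<le> s * norm y" and b: "0 \<le> b" "0 \<le> s" "b * s < 1"
  shows "surj (\<lambda>y. T y + S y)"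
proof -
  have T_inv: "T (inv T y) = y" for y using T(2) by (rule surj_f_inv_f)
  have inv_bound: "norm (inv T u - inv T w) \<le> b * norm (u - w)" for u w
    using T(3)[of "inv T u - inv T w"] by (simp add: linear_diff[OF T(1)] T_inv)
  have "\<exists>y. T y + S y = z" for z
  proof -
    have "\<exists>!y\<in>UNIV. inv T (z - S y) = y"
    proof (rule Banach_fix[where c = "b * s"])
      fix y w :: 'a
      have "dist (inv T (z - S y)) (inv T (z - S w)) \<le> b * norm (S (w - y))"
        using inv_bound[of "z - S y" "z - S w"] by (simp add: dist_norm linear_diff[OF S(1)])
      also have "\<dots> \<le> b * (s * dist y w)"
        using S(2)[of "w - y"] b by (intro mult_left_mono) (auto simp: dist_norm norm_minus_commute)
      finally show "dist (inv T (z - S y)) (inv T (z - S w)) \<le> b * s * dist y w" by (simp add: mult.assoc)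
    qed (use b in \<open>auto simp: complete_UNIV\<close>)
    then obtain y where "inv T (z - S y) = y" by auto
    then have "T y = z - S y" by (metis T_inv)
    then show ?thesis by (auto intro: exI[of _ y])
  qed
  then show ?thesis by (metis surjI)
qed

text \<open>Method of continuity: \<open>r\<close> is reached in \<open>n\<close> steps of size
  \<open>d\<close> with \<open>d * K < 1\<close>. The lower bound has constant 1 for every
  \<open>t\<close>, so the admissible step does not shrink on the way.\<close>

lemma surj_by_continuation:
  fixes A :: "'a::banach \<Rightarrow> 'a"
  assumes A: "bounded_linear A" and bound: "\<And>t y. 0 \<le> t \<Longrightarrow> norm y \<le> norm (y + t *\<^sub>R A y)"
    and r: "0 \<le> r"
  shows "surj (\<lambda>y. y + r *\<^sub>R A y)"
proof -
  obtain K where K: "K > 0" "\<And>y. norm (A y) \<le> norm y * K"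
    using bounded_linear.pos_bounded[OF A] by blast
  obtain n :: nat where n: "r * K < real n" using reals_Archimedean2 by blast
  have n0: "real n > 0" using n K(1) r by (meson le_less_trans mult_nonneg_nonneg less_imp_le)
  define d where "d = r / real n"
  have d: "0 \<le> d" "d * K < 1" using n n0 r by (auto simp: d_def field_simps)
  have lin: "linear (\<lambda>y. c *\<^sub>R A y)" for c
    using A by (intro bounded_linear.linear bounded_linear_const_scaleR)
  have "surj (\<lambda>y. y + (real k * d) *\<^sub>R A y)" for k
  proof (induction k)
    case (Suc k)
    have "surj (\<lambda>y. (y + (real k * d) *\<^sub>R A y) + d *\<^sub>R A y)"
    proof (rule surj_perturbation[where b = 1 and s = "d * K"])
      show "linear (\<lambda>y. y + (real k * d) *\<^sub>R A y)" by (intro linear_compose_add linear_ident lin)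
      show "norm (d *\<^sub>R A y) \<le> d * K * norm y" for y
        using mult_left_mono[OF K(2)[of y] d(1)] d(1) by (simp add: mult_ac)
    qed (use Suc bound d K lin in auto)
    then show ?case by (simp add: algebra_simps)
  qed (simp add: surj_def)
  from this[of n] show ?thesis using n0 by (simp add: d_def)
qed

text \<open>A support functional at \<open>y\<close> gives \<open>norm y\<close> on \<open>y\<close>
  and a nonnegative real part on \<open>A y\<close>, so the norm of the sum cannot drop below
  \<open>norm y\<close>.\<close>

lemma strongly_accretive_expanding:
  fixes A :: "'a::complex_normed_vector \<Rightarrow> 'a"
  assumes "strongly_accretive A" "0 \<le> t"
  shows "norm y \<le> norm (y + t *\<^sub>R A y)"
proof (cases "y = 0")
  case False
  obtain k where k: "k > 0" "\<And>x l. x \<noteq> 0 \<Longrightarrow> l \<in> support_functionals x \<Longrightarrow> Re (l (A x)) \<ge> k * norm x"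
    using assms(1) by (auto simp: strongly_accretive_def)
  obtain l where l: "l \<in> support_functionals y" using support_functionals_nonempty[OF False] .
  then have bl: "bounded_linear l" and ly: "l y = of_real (norm y)"
    by (auto simp: support_functionals_def bounded_clinear_def)
  have "0 \<le> Re (l (A y))" using k(2)[OF False l] k(1) by (smt (verit) mult_nonneg_nonneg norm_ge_zero)
  then have "norm y \<le> Re (l (y + t *\<^sub>R A y))"
    using assms(2) by (simp add: linear_simps(1,5)[OF bl] ly)
  also have "\<dots> \<le> norm (y + t *\<^sub>R A y)"
    using complex_Re_le_cmod support_functionals_norm_le[OF l] order_trans by blast
  finally show ?thesis .
qed simp

text \<open>The support functional argument for the nonlinear \<open>h\<close>; it confines all
  solutions in the unit ball, not only those found by contraction.\<close>

lemma resolvent_solution_norm_le: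
  fixes h :: "'a::complex_normed_vector \<Rightarrow> 'a"
  assumes acc: "\<forall>x\<in>ball 0 1 - {0}. \<forall>l\<in>support_functionals x. Re (l (h x)) > 0" and r: "r > 0"
    and w: "w \<in> ball 0 1" "w + r *\<^sub>R h w = z"
  shows "norm w \<le> norm z"
proof (cases "w = 0")
  case False
  obtain l where l: "l \<in> support_functionals w" using support_functionals_nonempty[OF False] .
  then have bl: "bounded_linear l" and lw: "l w = of_real (norm w)"
    by (auto simp: support_functionals_def bounded_clinear_def)
  have "norm w \<le> Re (l (w + r *\<^sub>R h w))"
    using acc w(1) False l r by (simp add: linear_simps(1,5)[OF bl] lw less_imp_le)
  also have "\<dots> \<le> norm z"
    using complex_Re_le_cmod support_functionals_norm_le[OF l] order_trans w(2) by blast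
  finally show ?thesis .
qed simp

text \<open>With \<open>E = Id + r A\<close> bijective and \<open>N\<close> the nonlinear rest of
  \<open>r h\<close>, the equation reads \<open>w = E^-1 (z - N w)\<close>. Since \<open>N\<close>
  has zero derivative at the origin and \<open>E^-1\<close> does not increase norms, the right side
  is a contraction near 0.\<close>

lemma resolvent_near_zero:
  fixes h :: "'a::complex_banach \<Rightarrow> 'a"
  assumes A: "bounded_clinear A" "strongly_accretive A" and h: "h \<in> class_N A" and r: "r > 0"
  obtains \<delta> where "\<delta> > 0" "resolvent h r \<in> Hol (ball 0 \<delta>)" "resolvent h r 0 = 0"
    "\<And>z. z \<in> ball 0 \<delta> \<Longrightarrow> resolvent h r z \<in> ball 0 1 \<and> resolvent h r z + r *\<^sub>R h (resolvent h r z) = z"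
proof -
  have hol: "h \<in> Hol (ball 0 1)" and h0: "h 0 = 0" and hA: "(h has_derivative A) (at 0)"
    and acc: "\<forall>x\<in>ball 0 1 - {0}. \<forall>l\<in>support_functionals x. Re (l (h x)) > 0"
    using h by (auto simp: class_N_def)
  define D where "D = fderiv h"
  have D0: "blinfun_apply (D 0) = A" unfolding D_def by (rule blinfun_apply_fderiv[OF hA])
  define J where "J = resolvent h r"
  define E where "E y = y + r *\<^sub>R A y" for y
  have expand: "norm y \<le> norm (E y)" for y
    unfolding E_def using strongly_accretive_expanding[OF A(2)] r by (simp add: less_imp_le)
  have blA: "bounded_linear A" using A(1) by (rule bounded_clinear_linear)
  have linE: "linear E"
    unfolding E_def using blA
    by (intro linear_compose_add linear_ident bounded_linear.linear bounded_linear_const_scaleR)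
  have surjE: "surj E"
    using surj_by_continuation[OF blA strongly_accretive_expanding[OF A(2)]] r
    unfolding E_def by (simp add: less_imp_le)
  define N where "N w = r *\<^sub>R (h w - A w)" for w
  have "isCont D 0"
    using Hol_has_derivative[OF Hol_fderiv[OF hol open_ball], of 0] has_derivative_continuous
    unfolding D_def by auto
  \<comment> \<open>After multiplication by \<open>r\<close> this tolerance becomes the contraction
    constant \<open>1 / 2\<close>.\<close>
  moreover have "1 / (2 * r) > 0" using r by simp
  ultimately obtain \<eta>0 where \<eta>0: "\<eta>0 > 0" "\<And>w. dist w 0 < \<eta>0 \<Longrightarrow> dist (D w) (D 0) < 1 / (2 * r)"
    unfolding continuous_at_eps_delta by metis
  define \<eta> where "\<eta> = min \<eta>0 1"
  have \<eta>: "\<eta> > 0" "\<eta> \<le> 1" "\<And>w. norm w < \<eta> \<Longrightarrow> norm (r *\<^sub>R (D w - D 0)) \<le> 1 / 2"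
  proof -
    show "norm (r *\<^sub>R (D w - D 0)) \<le> 1 / 2" if "norm w < \<eta>" for w
    proof -
      have "r * norm (D w - D 0) \<le> 1 / 2"
        using \<eta>0(2)[of w] that r by (simp add: \<eta>_def dist_norm field_simps)
      then show ?thesis using r by simp
    qed
  qed (use \<eta>0 in \<open>auto simp: \<eta>_def\<close>)
  have derN: "(N has_derivative blinfun_apply (r *\<^sub>R (D w - D 0))) (at w)" if "norm w < \<eta>" for w
  proof -
    have "(h has_derivative blinfun_apply (D w)) (at w)"
      unfolding D_def using that \<eta>(2) by (intro Hol_has_derivative[OF hol]) simp
    from has_derivative_scaleR_right[OF has_derivative_diff[OF this bounded_linear_imp_has_derivative[OF blA]]]
    have "(N has_derivative (\<lambda>u. r *\<^sub>R (blinfun_apply (D w) u - A u))) (at w)" unfolding N_def .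
    moreover have "(\<lambda>u. r *\<^sub>R (blinfun_apply (D w) u - A u)) = blinfun_apply (r *\<^sub>R (D w - D 0))"
      by (simp add: fun_eq_iff blinfun.scaleR_left blinfun.diff_left D0)
    ultimately show ?thesis by simp
  qed
  have N0: "N 0 = 0" by (simp add: N_def h0 linear_simps(3)[OF blA])
  have lipN: "norm (N v - N w) \<le> 1 / 2 * norm (v - w)" if "v \<in> cball 0 (\<eta> / 2)" "w \<in> cball 0 (\<eta> / 2)" for v w
  proof (rule differentiable_bound[OF convex_cball _ _ that])
    show "(N has_derivative blinfun_apply (r *\<^sub>R (D x - D 0))) (at x within cball 0 (\<eta> / 2))"
      if "x \<in> cball 0 (\<eta> / 2)" for x
      by (rule has_derivative_at_withinI[OF derN]) (use that \<eta>(1) in simp)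
    show "onorm (blinfun_apply (r *\<^sub>R (D x - D 0))) \<le> 1 / 2" if "x \<in> cball 0 (\<eta> / 2)" for x
      unfolding norm_blinfun.rep_eq[symmetric] by (rule \<eta>(3)) (use that \<eta>(1) in simp)
  qed
  \<comment> \<open>Half of the radius \<open>\<eta> / 2\<close> absorbs \<open>z\<close>, the other
    half absorbs \<open>N w\<close>, so the fixed point map preserves
    \<open>cball 0 (\<eta> / 2)\<close>.\<close>
  define \<delta> where "\<delta> = \<eta> / 4"
  have \<delta>: "\<delta> > 0" using \<eta> by (simp add: \<delta>_def)
  have E_inv: "E (inv E y) = y" for y using surjE by (rule surj_f_inv_f)
  have injE: "E v = E w \<Longrightarrow> v = w" for v w
    using expand[of "v - w"] by (simp add: linear_diff[OF linE])
  have eq: "w + r *\<^sub>R h w = z \<longleftrightarrow> inv E (z - N w) = w" for w z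
  proof -
    have "inv E (z - N w) = w \<longleftrightarrow> z - N w = E w" using E_inv injE by metis
    also have "\<dots> \<longleftrightarrow> w + r *\<^sub>R h w = z" by (auto simp: E_def N_def algebra_simps)
    finally show ?thesis by simp
  qed
  have sol: "J z \<in> ball 0 1 \<and> J z + r *\<^sub>R h (J z) = z" and Jz: "J z \<in> cball 0 (\<eta> / 2)"
    and Jle: "norm (J z) \<le> norm z" if z: "z \<in> ball 0 \<delta>" for z
  proof -
    have "\<exists>!w\<in>cball 0 (\<eta> / 2). inv E (z - N w) = w"
    proof (rule Banach_fix[where c = "1 / 2"])
      show "(\<lambda>w. inv E (z - N w)) ` cball 0 (\<eta> / 2) \<subseteq> cball 0 (\<eta> / 2)"
      proof (intro image_subsetI)
        fix w :: 'a assume w: "w \<in> cball 0 (\<eta> / 2)"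
        have "norm (inv E (z - N w)) \<le> norm (z - N w)"
          using expand[of "inv E (z - N w)"] by (simp add: E_inv)
        also have "\<dots> \<le> norm z + norm (N w)" by (rule norm_triangle_ineq4)
        also have "\<dots> \<le> \<eta> / 2"
          using lipN[OF w, of 0] w z \<eta>(1) by (simp add: N0 \<delta>_def)
        finally show "inv E (z - N w) \<in> cball 0 (\<eta> / 2)" by simp
      qed
      show "dist (inv E (z - N v)) (inv E (z - N w)) \<le> 1 / 2 * dist v w"
        if "v \<in> cball 0 (\<eta> / 2)" "w \<in> cball 0 (\<eta> / 2)" for v w
        using expand[of "inv E (z - N v) - inv E (z - N w)"] lipN[OF that]
        by (simp add: linear_diff[OF linE] E_inv dist_norm norm_minus_commute)
    qed (use \<eta> in \<open>auto simp: complete_eq_closed\<close>)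
    then obtain w where w: "w \<in> cball 0 (\<eta> / 2)" "w + r *\<^sub>R h w = z"
      and uniq: "\<And>v. v \<in> cball 0 (\<eta> / 2) \<Longrightarrow> v + r *\<^sub>R h v = z \<Longrightarrow> v = w"
      unfolding eq by metis
    \<comment> \<open>The \<open>THE\<close> in \<open>resolvent\<close> ranges over the whole unit
      ball, the fixed point theorem only over a smaller one. Every competitor \<open>v\<close>
      satisfies \<open>norm v \<le> norm z\<close> and so falls into the smaller ball.\<close>
    have "J z = w"
      unfolding J_def resolvent_def
    proof (rule the_equality)
      show "w \<in> ball 0 1 \<and> w + r *\<^sub>R h w = z" using w \<eta> by auto
      show "v = w" if "v \<in> ball 0 1 \<and> v + r *\<^sub>R h v = z" for v
        using resolvent_solution_norm_le[OF acc r, of v z] that z \<eta>(1) by (intro uniq) (auto simp: \<delta>_def)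
    qed
    then show "J z \<in> ball 0 1 \<and> J z + r *\<^sub>R h (J z) = z" "J z \<in> cball 0 (\<eta> / 2)" using w \<eta> by auto
    then show "norm (J z) \<le> norm z" using resolvent_solution_norm_le[OF acc r] by blast
  qed
  \<comment> \<open>Provides the continuity of \<open>J\<close> that the inverse function rule
    demands: when the equations for \<open>z\<close> and \<open>y\<close> are subtracted, the term
    with \<open>N\<close> is at most half of the left side and is absorbed there.\<close>
  have lipJ: "norm (J z - J y) \<le> 2 * norm (z - y)" if "z \<in> ball 0 \<delta>" "y \<in> ball 0 \<delta>" for z y
  proof -
    have "E (J z - J y) = (z - y) - (N (J z) - N (J y))"
    proof -
      have "E (J x) = x - N (J x)" if "x \<in> ball 0 \<delta>" for x
        using sol[OF that] by (simp add: E_def N_def algebra_simps)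
      then show ?thesis using that by (simp add: linear_diff[OF linE])
    qed
    then have "norm (J z - J y) \<le> norm (z - y) + norm (N (J z) - N (J y))"
      using expand[of "J z - J y"] norm_triangle_ineq4[of "z - y" "N (J z) - N (J y)"] by simp
    then show ?thesis using lipN[OF Jz[OF that(1)] Jz[OF that(2)]] by simp
  qed
  have derJ: "\<exists>F. bounded_clinear F \<and> (J has_derivative F) (at z)" if z: "z \<in> ball 0 \<delta>" for z
  proof -
    \<comment> \<open>The derivative of \<open>w + r h(w)\<close> at \<open>J z\<close>, written as
      \<open>E\<close> plus a perturbation of norm at most \<open>1 / 2\<close>; thus
      \<open>surj_perturbation\<close> applies and the inverse is bounded by 2.\<close>
    define F where "F u = E u + blinfun_apply (r *\<^sub>R (D (J z) - D 0)) u" for u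
    have Jz_less: "norm (J z) < \<eta>" using Jz[OF z] \<eta>(1) by simp
    have F_eq: "F u = u + r *\<^sub>R blinfun_apply (D (J z)) u" for u
      by (simp add: F_def E_def D0[symmetric] blinfun.scaleR_left blinfun.diff_left algebra_simps)
    have small: "norm (blinfun_apply (r *\<^sub>R (D (J z) - D 0)) u) \<le> 1 / 2 * norm u" for u
      using norm_blinfun[of "r *\<^sub>R (D (J z) - D 0)" u] mult_right_mono[OF \<eta>(3)[OF Jz_less], of "norm u"]
      by (meson norm_ge_zero order_trans)
    have "surj F"
      unfolding F_def
      by (rule surj_perturbation[where b = 1 and s = "1 / 2"])
        (use linE surjE expand small in \<open>auto intro: bounded_linear.linear blinfun.bounded_linear_right\<close>)
    then have F_inv: "F (inv F u) = u" for u by (rule surj_f_inv_f)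
    have F_exp: "norm u \<le> 2 * norm (F u)" for u
      using expand[of u] small[of u] norm_diff_ineq[of "E u" "blinfun_apply (r *\<^sub>R (D (J z) - D 0)) u"]
      by (simp add: F_def)
    have F_add: "F (u + v) = F u + F v" for u v
      by (simp add: F_eq blinfun.add_right scaleR_add_right)
    have F_scale: "F (c *\<^sub>C u) = c *\<^sub>C F u" for c u
    proof -
      have "blinfun_apply (D (J z)) (c *\<^sub>C u) = c *\<^sub>C blinfun_apply (D (J z)) u"
        unfolding D_def using sol[OF z]
        by (intro bounded_clinear_scaleC[OF Hol_bounded_clinear_fderiv[OF hol]]) simp
      then show ?thesis by (simp add: F_eq scaleC_add_right scaleC_scaleR)
    qed
    have F_zero: "F u = 0 \<Longrightarrow> u = 0" for u using F_exp[of u] by simp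
    have F_diff: "F (u - v) = F u - F v" for u v using F_add[of "u - v" v] by simp
    have F_inj: "F u = F v \<Longrightarrow> u = v" for u v
      using F_zero[of "u - v"] by (simp add: F_diff)
    have F_scaleR: "F (c *\<^sub>R u) = c *\<^sub>R F u" for c u by (simp add: scaleR_scaleC F_scale)
    have bl: "bounded_linear (inv F)"
    proof (rule bounded_linear_intro)
      show "inv F (u + v) = inv F u + inv F v" for u v by (rule F_inj) (simp add: F_add F_inv)
      show "inv F (c *\<^sub>R u) = c *\<^sub>R inv F u" for c u by (rule F_inj) (simp add: F_scaleR F_inv)
      show "norm (inv F u) \<le> norm u * 2" for u using F_exp[of "inv F u"] by (simp add: F_inv)
    qed
    have "(J has_derivative inv F) (at z)"
    proof (rule has_derivative_inverse_basic[where f = "\<lambda>w. w + r *\<^sub>R h w" and f' = F and T = "ball 0 \<delta>"])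
      show "((\<lambda>w. w + r *\<^sub>R h w) has_derivative F) (at (J z))"
        unfolding F_eq D_def using sol[OF z]
        by (auto intro!: derivative_eq_intros Hol_has_derivative[OF hol])
      show "inv F \<circ> F = id" using F_inj F_inv by (auto simp: fun_eq_iff)
      show "continuous (at z) J"
      proof -
        have "continuous_on (ball 0 \<delta>) J"
          by (rule lipschitz_on_continuous_on[of 2]) (auto simp: lipschitz_on_def dist_norm intro!: lipJ)
        then show ?thesis using z continuous_on_interior by (metis open_ball interior_open)
      qed
    qed (use z sol bl in auto)
    moreover have "inv F (c *\<^sub>C u) = c *\<^sub>C inv F u" for c u by (rule F_inj) (simp add: F_scale F_inv)
    ultimately show ?thesis using bl by (auto simp: bounded_clinear_def)
  qed
  show ?thesis
  proof (rule that[OF \<delta>])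
    show "resolvent h r \<in> Hol (ball 0 \<delta>)" using derJ by (simp add: Hol_def J_def)
    show "resolvent h r 0 = 0" using Jle[of 0] \<delta> by (simp add: J_def)
  qed (use sol in \<open>simp add: J_def\<close>)
qed

subsection \<open>Derivatives of the resolvent at the origin\<close>

lemma Hol_has_vector_derivative:
  assumes "f \<in> Hol U" "c t \<in> U" "(c has_vector_derivative c') (at t)"
  shows "((\<lambda>t. f (c t)) has_vector_derivative blinfun_apply (fderiv f (c t)) c') (at t)"
  using has_derivative_compose[OF assms(3)[unfolded has_vector_derivative_def] Hol_has_derivative[OF assms(1,2)]]
  by (simp add: has_vector_derivative_def blinfun.scaleR_right)

text \<open>The identity \<open>J + r h(J) = id\<close> is differentiated along real lines. The
  first and second order identities are kept at every point of the small ball, because each has to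
  be differentiated once more; the third is taken at 0 only.\<close>

lemma resolvent_derivatives_at_zero:
  fixes h J :: "'a::complex_banach \<Rightarrow> 'a"
  assumes h: "h \<in> Hol (ball 0 1)" and \<delta>: "\<delta> > 0" and J: "J \<in> Hol (ball 0 \<delta>)" "J 0 = 0"
    and eq: "\<And>z. z \<in> ball 0 \<delta> \<Longrightarrow> J z \<in> ball 0 1 \<and> J z + r *\<^sub>R h (J z) = z"
  defines "E \<equiv> \<lambda>y. y + r *\<^sub>R blinfun_apply (fderiv h 0) y" and "B \<equiv> blinfun_apply (fderiv J 0)"
  shows "E (B u) = u"
    and "E (D2 J 0 u v) = - r *\<^sub>R D2 h 0 (B u) (B v)"
    and "E (D3 J 0 u u u) = - r *\<^sub>R (D3 h 0 (B u) (B u) (B u) + 3 *\<^sub>R D2 h 0 (B u) (D2 J 0 u u))"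
proof -
  have h1: "fderiv h \<in> Hol (ball 0 1)" and J1: "fderiv J \<in> Hol (ball 0 \<delta>)"
    using h J(1) by (auto intro: Hol_fderiv)
  then have h2: "fderiv (fderiv h) \<in> Hol (ball 0 1)" and J2: "fderiv (fderiv J) \<in> Hol (ball 0 \<delta>)"
    by (auto intro: Hol_fderiv)
  note apply_deriv = bounded_bilinear.has_vector_derivative[OF bounded_bilinear_blinfun_apply]
  have line: "((\<lambda>s. z + s *\<^sub>R u) has_vector_derivative u) (at 0)" for z u :: 'a
    by (auto intro!: derivative_eq_intros)
  note chain = Hol_has_vector_derivative[where t = 0 and c = "\<lambda>s. z + s *\<^sub>R u" for z u, OF _ _ line, simplified]
  \<comment> \<open>Maps that agree on the open ball agree along a line through \<open>z\<close> for
    small \<open>s\<close>, so their derivatives there coincide; this is how an identity is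
    differentiated.\<close>
  have const: "d = k'" if "z \<in> ball 0 \<delta>" and \<Phi>: "\<And>y. y \<in> ball 0 \<delta> \<Longrightarrow> \<Phi> y = \<Psi> y"
    and "((\<lambda>s. \<Phi> (z + s *\<^sub>R u)) has_vector_derivative d) (at 0)"
    and "((\<lambda>s. \<Psi> (z + s *\<^sub>R u)) has_vector_derivative k') (at 0)" for \<Phi> \<Psi> :: "'a \<Rightarrow> 'a" and d z u k'
  proof -
    have "((\<lambda>s. z + s *\<^sub>R u) \<longlongrightarrow> z + 0 *\<^sub>R u) (at 0)" by (intro tendsto_intros)
    then have "\<forall>\<^sub>F s in at 0. z + s *\<^sub>R u \<in> ball 0 \<delta>"
      using that(1) by (intro topological_tendstoD) auto
    then have "\<forall>\<^sub>F s in at 0. \<Phi> (z + s *\<^sub>R u) = \<Psi> (z + s *\<^sub>R u)"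
      by eventually_elim (rule \<Phi>)
    then have "((\<lambda>s. \<Psi> (z + s *\<^sub>R u)) has_vector_derivative d) (at 0)"
      using that(3) \<Phi>[OF that(1)] unfolding has_vector_derivative_def
      by (auto elim!: has_derivative_transform_eventually)
    then show ?thesis using that(4) vector_derivative_unique_at by blast
  qed
  let ?h1 = "\<lambda>z. blinfun_apply (fderiv h (J z))" and ?J1 = "\<lambda>z. blinfun_apply (fderiv J z)"
  have dJ: "((\<lambda>s. J (z + s *\<^sub>R u)) has_vector_derivative ?J1 z u) (at 0)" if "z \<in> ball 0 \<delta>" for z u
    using chain[OF J(1)] that by simp
  have id1: "?J1 z v + r *\<^sub>R ?h1 z (?J1 z v) = v" if z: "z \<in> ball 0 \<delta>" for z v
  proof (rule const[OF z, of "\<lambda>y. J y + r *\<^sub>R h (J y)" "\<lambda>y. y" v])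
    have "((\<lambda>s. h (J (z + s *\<^sub>R v))) has_vector_derivative ?h1 z (?J1 z v)) (at 0)"
      using Hol_has_vector_derivative[OF h _ dJ[OF z]] eq[OF z] by simp
    then show "((\<lambda>s. J (z + s *\<^sub>R v) + r *\<^sub>R h (J (z + s *\<^sub>R v))) has_vector_derivative
        ?J1 z v + r *\<^sub>R ?h1 z (?J1 z v)) (at 0)"
      using dJ[OF z] by (auto intro!: derivative_eq_intros)
  qed (use eq line in auto)
  have d1: "((\<lambda>s. ?J1 (z + s *\<^sub>R u) v) has_vector_derivative D2 J z u v) (at 0)" if "z \<in> ball 0 \<delta>" for z u v
    unfolding D2_def
    using apply_deriv[OF chain[OF J1] has_vector_derivative_const, of z u v] that by (simp add: blinfun.zero_right)
  have d1h: "((\<lambda>s. fderiv h (J (z + s *\<^sub>R u))) has_vector_derivative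
      blinfun_apply (fderiv (fderiv h) (J z)) (?J1 z u)) (at 0)" if "z \<in> ball 0 \<delta>" for z u
    using Hol_has_vector_derivative[OF h1 _ dJ[OF that]] eq[OF that] by simp
  have id2: "D2 J z u v + r *\<^sub>R (?h1 z (D2 J z u v) + D2 h (J z) (?J1 z u) (?J1 z v)) = 0"
    if z: "z \<in> ball 0 \<delta>" for z u v
  proof (rule const[OF z id1])
    show "((\<lambda>s. ?J1 (z + s *\<^sub>R u) v + r *\<^sub>R ?h1 (z + s *\<^sub>R u) (?J1 (z + s *\<^sub>R u) v)) has_vector_derivative
        D2 J z u v + r *\<^sub>R (?h1 z (D2 J z u v) + D2 h (J z) (?J1 z u) (?J1 z v))) (at 0)"
      using apply_deriv[OF d1h[OF z] d1[OF z], of u u v] d1[OF z, of u v]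
      by (auto intro!: derivative_eq_intros simp: D2_def)
  qed auto
  have z0: "0 \<in> ball 0 \<delta>" using \<delta> by simp
  show "E (B u) = u" using id1[OF z0, of u] by (simp add: E_def B_def J)
  show "E (D2 J 0 u v) = - r *\<^sub>R D2 h 0 (B u) (B v)"
    using id2[OF z0, of u v] by (simp add: E_def B_def J algebra_simps eq_neg_iff_add_eq_0)
  have d2: "((\<lambda>s. D2 J (0 + s *\<^sub>R u) u u) has_vector_derivative D3 J 0 u u u) (at 0)"
    unfolding D2_def D3_def
    using apply_deriv[OF apply_deriv[OF chain[OF J2] has_vector_derivative_const] has_vector_derivative_const,
        of 0 u u u] z0
    by (simp add: blinfun.zero_right)
  have d2h: "((\<lambda>s. D2 h (J (0 + s *\<^sub>R u)) (?J1 (0 + s *\<^sub>R u) u) (?J1 (0 + s *\<^sub>R u) u)) has_vector_derivative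
      D2 h 0 (B u) (D2 J 0 u u) + (D2 h 0 (D2 J 0 u u) (B u) + D3 h 0 (B u) (B u) (B u))) (at 0)"
  proof -
    have "((\<lambda>s. fderiv (fderiv h) (J (0 + s *\<^sub>R u))) has_vector_derivative
        blinfun_apply (fderiv (fderiv (fderiv h)) (J 0)) (?J1 0 u)) (at 0)"
      using Hol_has_vector_derivative[OF h2 _ dJ[OF z0]] eq[OF z0] by simp
    from apply_deriv[OF apply_deriv[OF this d1[OF z0]] d1[OF z0], of u u u u]
    show ?thesis by (simp add: D2_def D3_def B_def J blinfun.add_left)
  qed
  \<comment> \<open>Three mixed terms occur: one from the operator \<open>fderiv h\<close> applied
    to \<open>D2 J\<close>, two from the arguments of \<open>D2 h\<close>. Symmetry makes them
    equal, which gives the factor 3.\<close>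
  have symm: "D2 h 0 (D2 J 0 u u) (B u) = D2 h 0 (B u) (D2 J 0 u u)"
    unfolding D2_def by (rule fderiv_fderiv_symmetric[OF h]) auto
  have "D3 J 0 u u u + r *\<^sub>R (blinfun_apply (fderiv h 0) (D3 J 0 u u u) + D2 h 0 (B u) (D2 J 0 u u)
      + (D2 h 0 (B u) (D2 J 0 u u) + (D2 h 0 (D2 J 0 u u) (B u) + D3 h 0 (B u) (B u) (B u)))) = 0"
  proof (rule const[OF z0 id2])
    show "((\<lambda>s. D2 J (0 + s *\<^sub>R u) u u + r *\<^sub>R (?h1 (0 + s *\<^sub>R u) (D2 J (0 + s *\<^sub>R u) u u)
        + D2 h (J (0 + s *\<^sub>R u)) (?J1 (0 + s *\<^sub>R u) u) (?J1 (0 + s *\<^sub>R u) u))) has_vector_derivative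
      D3 J 0 u u u + r *\<^sub>R (blinfun_apply (fderiv h 0) (D3 J 0 u u u) + D2 h 0 (B u) (D2 J 0 u u)
      + (D2 h 0 (B u) (D2 J 0 u u) + (D2 h 0 (D2 J 0 u u) (B u) + D3 h 0 (B u) (B u) (B u))))) (at 0)"
      using apply_deriv[OF d1h[OF z0] d2, of u]
      by (intro derivative_eq_intros has_vector_derivative_add d2 d2h bounded_linear.has_vector_derivative[OF bounded_linear_scaleR_right])
        (auto simp: D2_def B_def J)
  qed auto
  then show "E (D3 J 0 u u u) = - r *\<^sub>R (D3 h 0 (B u) (B u) (B u) + 3 *\<^sub>R D2 h 0 (B u) (D2 J 0 u u))"
    unfolding symm
    by (simp add: E_def algebra_simps eq_neg_iff_add_eq_0 scaleR_2 scaleR_left_distrib[of 1 2, simplified])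
qed

subsection \<open>Coefficients of subordinate functions\<close>

lemma schwarz_pick_at_zero:
  assumes hol: "\<xi> holomorphic_on ball 0 1" and le: "\<And>z. z \<in> ball 0 1 \<Longrightarrow> cmod (\<xi> z) \<le> 1"
  shows "cmod (deriv \<xi> 0) \<le> 1 - (cmod (\<xi> 0))\<^sup>2"
proof (cases "\<exists>w\<in>ball 0 1. cmod (\<xi> w) = 1")
  case True
  then obtain w where w: "w \<in> ball 0 1" "cmod (\<xi> w) = 1" by blast
  have "\<xi> constant_on ball 0 1"
    using w le by (intro maximum_modulus_principle[OF hol, of "ball 0 1" w]) auto
  then obtain c where c: "\<And>z. z \<in> ball 0 1 \<Longrightarrow> \<xi> z = c" by (auto simp: constant_on_def)
  have "(\<xi> has_field_derivative 0) (at 0)"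
    by (rule has_field_derivative_transform_within_open[of "\<lambda>_. c" _ _ "ball 0 1"]) (auto simp: c)
  then show ?thesis using le[of 0] by (simp add: DERIV_imp_deriv power_le_one)
next
  case False
  then have less: "cmod (\<xi> z) < 1" if "z \<in> ball 0 1" for z using le[OF that] that by force
  define a where "a = \<xi> 0"
  have a: "cmod a < 1" using less[of 0] by (simp add: a_def)
  then have a2: "(cmod a)\<^sup>2 < 1" by (simp add: power_less_one_iff)
  have aa: "cnj a * a = of_real ((cmod a)\<^sup>2)" using complex_norm_square[of a] by (simp add: mult.commute)
  then have nz: "1 - cnj a * a \<noteq> 0" using a2
    by (metis eq_iff_diff_eq_0 less_irrefl of_real_eq_1_iff)
  define f where "f z = Moebius_function 0 a (\<xi> z)" for z
  have "f holomorphic_on ball 0 1"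
    unfolding f_def
    by (rule holomorphic_on_compose_gen[OF hol Moebius_function_holomorphic[OF a, of 0], unfolded o_def])
      (use less in auto)
  moreover have "f 0 = 0" by (simp add: f_def a_def Moebius_function_eq_zero)
  ultimately have "cmod (deriv f 0) \<le> 1"
    using less by (intro Schwarz_Lemma(2)[where \<xi> = 0]) (auto simp: f_def intro: Moebius_function_norm_lt_1 a)
  moreover have "(f has_field_derivative deriv \<xi> 0 / (1 - cnj a * a)) (at 0)"
  proof -
    have "(\<xi> has_field_derivative deriv \<xi> 0) (at 0)"
      by (rule holomorphic_derivI[OF hol]) auto
    then have "((\<lambda>z. (\<xi> z - a) / (1 - cnj a * \<xi> z)) has_field_derivative
        deriv \<xi> 0 * (1 - cnj a * a) / ((1 - cnj a * a) * (1 - cnj a * a))) (at 0)"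
      using nz by (auto intro!: derivative_eq_intros simp: a_def[symmetric])
    then show ?thesis using nz by (simp add: f_def[abs_def] Moebius_function_simple)
  qed
  moreover have "cmod (1 - cnj a * a) = 1 - (cmod a)\<^sup>2"
  proof -
    have "1 - cnj a * a = of_real (1 - (cmod a)\<^sup>2)" by (simp add: aa)
    then show ?thesis using a2 by (simp only: norm_of_real)
  qed
  ultimately have "cmod (deriv \<xi> 0) / (1 - (cmod a)\<^sup>2) \<le> 1"
    by (simp only: DERIV_imp_deriv norm_divide)
  then show ?thesis using a2 by (simp add: a_def)
qed

text \<open>Multiplication by \<open>z\<close> shifts Taylor coefficients by one: at 0 only the term
  \<open>i = 1\<close> of the Leibniz sum survives.\<close>

lemma higher_deriv_times_ident:
  assumes F: "F holomorphic_on ball 0 1" and \<psi>: "\<And>z. z \<in> ball 0 1 \<Longrightarrow> \<psi> z = z * F z"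
  shows "(deriv ^^ Suc n) \<psi> 0 = of_nat (Suc n) * (deriv ^^ n) F 0"
proof -
  have hol: "(\<lambda>z. z * F z) holomorphic_on ball 0 1" by (intro holomorphic_intros F)
  then have "\<psi> holomorphic_on ball 0 1" by (rule holomorphic_transform) (simp add: \<psi>)
  then have "(deriv ^^ Suc n) \<psi> 0 = (deriv ^^ Suc n) (\<lambda>z. z * F z) 0"
    by (rule higher_deriv_transform_within_open[OF _ hol open_ball]) (simp_all add: \<psi>)
  also have "\<dots> = (\<Sum>i = 0..Suc n. of_nat (Suc n choose i) * (deriv ^^ i) (\<lambda>z. z) 0 * (deriv ^^ (Suc n - i)) F 0)"
    by (rule higher_deriv_mult[OF holomorphic_on_ident F]) auto
  also have "\<dots> = (\<Sum>i = 0..Suc n. if i = 1 then of_nat (Suc n) * (deriv ^^ n) F 0 else 0)"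
    by (intro sum.cong refl) (auto simp: higher_deriv_ident simp del: funpow.simps)
  also have "\<dots> = of_nat (Suc n) * (deriv ^^ n) F 0" by (simp del: funpow.simps)
  finally show ?thesis .
qed

text \<open>Dividing by \<open>z\<close> turns the first two coefficients of \<open>\<omega>\<close>
  into the value and the derivative of \<open>\<xi>\<close> at 0, which are related by
  Schwarz-Pick.\<close>

lemma schwarz_second_coeff:
  assumes hol: "\<omega> holomorphic_on ball 0 1" and 0: "\<omega> 0 = 0"
    and less: "\<And>z. z \<in> ball 0 1 \<Longrightarrow> cmod (\<omega> z) < 1"
  shows "cmod (deriv (deriv \<omega>) 0 / 2) \<le> 1 - (cmod (deriv \<omega> 0))\<^sup>2"
proof -
  obtain \<xi> where \<xi>: "\<xi> holomorphic_on ball 0 1" "\<And>z. norm z < 1 \<Longrightarrow> \<omega> z = z * \<xi> z" "deriv \<omega> 0 = \<xi> 0"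
    using Schwarz3[OF hol 0] by blast
  have "cmod (\<xi> z) \<le> 1" if z: "z \<in> ball 0 1" for z
  proof (cases "z = 0")
    case True
    then show ?thesis using Schwarz_Lemma(2)[OF hol 0, of 0] less \<xi>(3) by auto
  next
    case False
    then show ?thesis
      using Schwarz_Lemma(1)[OF hol 0, of z] less \<xi>(2)[of z] z by (auto simp: norm_mult)
  qed
  from schwarz_pick_at_zero[OF \<xi>(1) this] show ?thesis
    using higher_deriv_times_ident[OF \<xi>(1), of \<omega> 1] \<xi> by simp
qed

text \<open>\<open>M\<close> is minus a \<open>Moebius_function\<close>; the sign makes it exchange
  0 and \<open>a\<close>. Being its own inverse, it also inverts the inner map of
  \<open>ghat\<close>.\<close>

lemma moebius_involution:
  assumes a: "cmod a < 1"
  defines "M \<equiv> \<lambda>t. (a - t) / (1 - t * cnj a)"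
  shows "M holomorphic_on ball 0 1" and "\<And>t. t \<in> ball 0 1 \<Longrightarrow> M t \<in> ball 0 1"
    and "\<And>t. t \<in> ball 0 1 \<Longrightarrow> M (M t) = t"
proof -
  have M: "M t = - Moebius_function 0 a t" for t
    using minus_divide_left[of "t - a" "1 - t * cnj a"]
    by (simp add: M_def Moebius_function_simple mult.commute)
  show "M holomorphic_on ball 0 1"
    unfolding M by (intro holomorphic_intros Moebius_function_holomorphic a)
  show ball: "M t \<in> ball 0 1" if "t \<in> ball 0 1" for t
    using that Moebius_function_norm_lt_1[OF a, of t 0] by (simp add: M)
  show "M (M t) = t" if "t \<in> ball 0 1" for t
  proof -
    \<comment> \<open>The two signs together turn the outer parameter \<open>a\<close> into
      \<open>- a\<close>, which is the standard inverse.\<close>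
    have "M (M t) = Moebius_function 0 (- a) (Moebius_function 0 a t)"
      using minus_divide_left[of "- Moebius_function 0 a t - a" "1 + cnj a * Moebius_function 0 a t"]
      by (simp add: M Moebius_function_simple[of a "- _"] Moebius_function_simple[of "- a"])
    then show ?thesis
      using Moebius_function_compose[of "- a" a t] a that by simp
  qed
qed

text \<open>After filling in the origin, \<open>\<psi> t / t\<close> maps the disc into the image of
  \<open>g\<close>, so it is \<open>ghat\<close> after a Schwarz function with coefficients
  \<open>c1\<close> and \<open>c2\<close>. Division by \<open>t\<close> lowers the index:
  coefficients 2 and 3 of \<open>\<psi>\<close> are coefficients 1 and 2 of the composition.\<close>

lemma subordinate_coefficients:
  fixes g \<psi> :: "complex \<Rightarrow> complex" and \<tau> :: complex
  assumes g: "biholomorphic_onto_image (ball 0 1) g"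
    and \<psi>: "\<psi> holomorphic_on ball 0 1" "\<psi> 0 = 0"
    and \<tau>: "\<tau> \<in> ball 0 1" "g \<tau> = deriv \<psi> 0"
    and range: "\<And>t. t \<in> ball 0 1 \<Longrightarrow> t \<noteq> 0 \<Longrightarrow> \<psi> t / t \<in> g ` ball 0 1"
  defines "ghat \<equiv> \<lambda>t. g ((\<tau> - t) / (1 - t * cnj \<tau>))"
  obtains c1 c2 where "cmod c2 \<le> 1 - (cmod c1)\<^sup>2" "taylor_coeff ghat 1 \<noteq> 0"
    "taylor_coeff \<psi> 2 = taylor_coeff ghat 1 * c1"
    "taylor_coeff \<psi> 3 = taylor_coeff ghat 1 * c2 + taylor_coeff ghat 2 * c1\<^sup>2"
proof -
  define M where "M t = (\<tau> - t) / (1 - t * cnj \<tau>)" for t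
  have M: "M holomorphic_on ball 0 1" "\<And>t. t \<in> ball 0 1 \<Longrightarrow> M t \<in> ball 0 1"
      "\<And>t. t \<in> ball 0 1 \<Longrightarrow> M (M t) = t"
    using moebius_involution[of \<tau>] \<tau>(1) by (simp_all add: M_def[abs_def])
  have ghat: "ghat t = g (M t)" for t by (simp add: ghat_def M_def)
  let ?gi = "inv_into (ball 0 1) g"
  have ghol: "g holomorphic_on ball 0 1" and ginj: "inj_on g (ball 0 1)"
    and gi: "?gi holomorphic_on (g ` ball 0 1)"
    using g by (auto simp: biholomorphic_onto_image_def)
  have ghat_hol: "ghat holomorphic_on ball 0 1"
    unfolding ghat[abs_def]
    by (rule holomorphic_on_compose_gen[OF M(1) ghol, unfolded o_def]) (use M(2) in blast)
  have "inj_on ghat (ball 0 1)"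
    by (rule inj_onI) (metis M(2,3) ghat ginj inj_onD)
  \<comment> \<open>An injective holomorphic function has no critical point; this justifies the
    later division by \<open>q1\<close>.\<close>
  then have q1: "deriv ghat 0 \<noteq> 0"
    by (intro holomorphic_injective_imp_regular[OF ghat_hol]) auto
  obtain \<phi> where \<phi>: "\<phi> holomorphic_on ball 0 1" "\<And>z. norm z < 1 \<Longrightarrow> \<psi> z = z * \<phi> z" "deriv \<psi> 0 = \<phi> 0"
    using Schwarz3[OF \<psi>] by blast
  have \<phi>_range: "\<phi> t \<in> g ` ball 0 1" if t: "t \<in> ball 0 1" for t
  proof (cases "t = 0")
    case True
    \<comment> \<open>At 0 the quotient is read as \<open>deriv \<psi> 0\<close>, which equals
      \<open>g \<tau>\<close>.\<close>
    then show ?thesis using \<tau> \<phi>(3) by (metis imageI)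
  next
    case False
    then show ?thesis using range[OF t] \<phi>(2)[of t] t by simp
  qed
  \<comment> \<open>Since \<open>M\<close> is self-inverse, this is the inverse of
    \<open>ghat\<close> applied to \<open>\<phi> t\<close>.\<close>
  define \<omega> where "\<omega> t = M (?gi (\<phi> t))" for t
  have gi_ball: "?gi (\<phi> t) \<in> ball 0 1" if "t \<in> ball 0 1" for t
    using \<phi>_range[OF that] by (rule inv_into_into)
  have \<omega>_hol: "\<omega> holomorphic_on ball 0 1"
  proof -
    have "(?gi \<circ> \<phi>) holomorphic_on ball 0 1"
      using \<phi>_range by (intro holomorphic_on_compose_gen[OF \<phi>(1) gi]) auto
    from holomorphic_on_compose_gen[OF this M(1), unfolded o_def] show ?thesis
      unfolding \<omega>_def[abs_def] using gi_ball by blast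
  qed
  have \<omega>_ball: "\<omega> t \<in> ball 0 1" if "t \<in> ball 0 1" for t
    unfolding \<omega>_def by (intro M(2) gi_ball that)
  have \<omega>0: "\<omega> 0 = 0"
  proof -
    have "?gi (\<phi> 0) = \<tau>" using \<tau> \<phi>(3) ginj by (metis inv_into_f_f)
    then show ?thesis by (simp add: \<omega>_def M_def)
  qed
  have eq: "\<phi> t = ghat (\<omega> t)" if t: "t \<in> ball 0 1" for t
    using M(3)[OF gi_ball[OF t]] f_inv_into_f[OF \<phi>_range[OF t]] by (simp add: ghat \<omega>_def)
  have d1: "deriv \<phi> t = deriv ghat (\<omega> t) * deriv \<omega> t" if t: "t \<in> ball 0 1" for t
  proof -
    have "((\<lambda>t. ghat (\<omega> t)) has_field_derivative deriv ghat (\<omega> t) * deriv \<omega> t) (at t)"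
      by (rule DERIV_chain2[OF holomorphic_derivI[OF ghat_hol _ \<omega>_ball[OF t]] holomorphic_derivI[OF \<omega>_hol _ t]]) auto
    then have "(\<phi> has_field_derivative deriv ghat (\<omega> t) * deriv \<omega> t) (at t)"
      by (rule has_field_derivative_transform_within_open[OF _ open_ball t]) (simp add: eq)
    then show ?thesis by (rule DERIV_imp_deriv)
  qed
  have d2: "deriv (deriv \<phi>) 0 = deriv ghat 0 * deriv (deriv \<omega>) 0 + deriv (deriv ghat) 0 * (deriv \<omega> 0)\<^sup>2"
  proof -
    have 0: "(0::complex) \<in> ball 0 1" by simp
    have "(deriv ghat has_field_derivative deriv (deriv ghat) (\<omega> 0)) (at (\<omega> 0))"
      using holomorphic_deriv[OF ghat_hol open_ball] \<omega>_ball[OF 0] by (intro holomorphic_derivI) auto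
    from DERIV_mult[OF DERIV_chain2[OF this holomorphic_derivI[OF \<omega>_hol open_ball 0]]
        holomorphic_derivI[OF holomorphic_deriv[OF \<omega>_hol open_ball] open_ball 0]]
    have "((\<lambda>t. deriv ghat (\<omega> t) * deriv \<omega> t) has_field_derivative
        deriv ghat 0 * deriv (deriv \<omega>) 0 + deriv (deriv ghat) 0 * (deriv \<omega> 0)\<^sup>2) (at 0)"
      by (simp add: \<omega>0 power2_eq_square algebra_simps)
    then have "(deriv \<phi> has_field_derivative
        deriv ghat 0 * deriv (deriv \<omega>) 0 + deriv (deriv ghat) 0 * (deriv \<omega> 0)\<^sup>2) (at 0)"
      by (rule has_field_derivative_transform_within_open[OF _ open_ball 0]) (simp add: d1)
    then show ?thesis by (rule DERIV_imp_deriv)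
  qed
  note times = higher_deriv_times_ident[OF \<phi>(1), of \<psi>]
  show ?thesis
  proof (rule that)
    show "cmod (deriv (deriv \<omega>) 0 / 2) \<le> 1 - (cmod (deriv \<omega> 0))\<^sup>2"
      using \<omega>_ball by (intro schwarz_second_coeff \<omega>_hol \<omega>0) auto
    show "taylor_coeff ghat 1 \<noteq> 0" using q1 by (simp add: taylor_coeff_def)
    show "taylor_coeff \<psi> 2 = taylor_coeff ghat 1 * deriv \<omega> 0"
      using times[of 1] \<phi>(2) d1[of 0] \<omega>0 by (simp add: taylor_coeff_def numeral_2_eq_2)
    show "taylor_coeff \<psi> 3 = taylor_coeff ghat 1 * (deriv (deriv \<omega>) 0 / 2) + taylor_coeff ghat 2 * (deriv \<omega> 0)\<^sup>2"
      using times[of 2] \<phi>(2) d2 by (simp add: taylor_coeff_def numeral_2_eq_2 numeral_3_eq_3 field_simps)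
  qed
qed

section \<open>The coefficient functional of the resolvent\<close>

lemma taylor_coeff_along_line:
  fixes h :: "'a::complex_banach \<Rightarrow> 'a" and l :: "'a \<Rightarrow> complex"
  assumes h: "h \<in> Hol (ball 0 1)" and l: "bounded_clinear l" and u: "norm u = 1"
  defines "\<psi> \<equiv> \<lambda>t. l (h (t *\<^sub>C u))"
  shows "\<psi> holomorphic_on ball 0 1" and "deriv \<psi> 0 = l (blinfun_apply (fderiv h 0) u)"
    and "taylor_coeff \<psi> 2 = l (D2 h 0 u u) / 2" and "taylor_coeff \<psi> 3 = l (D3 h 0 u u u) / 6"
proof -
  have h1: "fderiv h \<in> Hol (ball 0 1)" using h by (rule Hol_fderiv) simp
  then have h2: "fderiv (fderiv h) \<in> Hol (ball 0 1)" by (rule Hol_fderiv) simp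
  have ball: "0 + t *\<^sub>C u \<in> ball 0 1" if "t \<in> ball 0 1" for t using that u by (simp add: norm_scaleC)
  \<comment> \<open>Evaluation at \<open>u\<close> followed by \<open>l\<close> is a functional on
    the operator spaces, so each derivative of \<open>\<psi>\<close> again has the form treated by
    \<open>Hol_line_deriv\<close>.\<close>
  let ?l1 = "\<lambda>T. l (blinfun_apply T u)" and ?l2 = "\<lambda>T. l (blinfun_apply (blinfun_apply T u) u)"
  have l1: "bounded_clinear ?l1" using l by (rule bounded_clinear_blinfun_apply)
  then have l2: "bounded_clinear ?l2" by (rule bounded_clinear_blinfun_apply)
  have der: "((\<lambda>t. l (h (t *\<^sub>C u))) has_field_derivative ?l1 (fderiv h (t *\<^sub>C u))) (at t)"
    "((\<lambda>t. ?l1 (fderiv h (t *\<^sub>C u))) has_field_derivative ?l2 (fderiv (fderiv h) (t *\<^sub>C u))) (at t)"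
    "((\<lambda>t. ?l2 (fderiv (fderiv h) (t *\<^sub>C u))) has_field_derivative
       l (D3 h (t *\<^sub>C u) u u u)) (at t)" if "t \<in> ball 0 1" for t
    using Hol_line_deriv[OF h l ball[OF that]] Hol_line_deriv[OF h1 l1 ball[OF that]]
      Hol_line_deriv[OF h2 l2 ball[OF that]] by (simp_all add: D3_def)
  show "\<psi> holomorphic_on ball 0 1"
    unfolding \<psi>_def holomorphic_on_open[OF open_ball] using der(1) by blast
  have e1: "deriv \<psi> t = ?l1 (fderiv h (t *\<^sub>C u))" if "t \<in> ball 0 1" for t
    unfolding \<psi>_def by (rule DERIV_imp_deriv[OF der(1)[OF that]])
  have e2: "deriv (deriv \<psi>) t = ?l2 (fderiv (fderiv h) (t *\<^sub>C u))" if t: "t \<in> ball 0 1" for t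
    by (rule DERIV_imp_deriv, rule has_field_derivative_transform_within_open[OF der(2)[OF t] open_ball t])
      (simp add: e1)
  have e3: "deriv (deriv (deriv \<psi>)) t = l (D3 h (t *\<^sub>C u) u u u)" if t: "t \<in> ball 0 1" for t
    by (rule DERIV_imp_deriv, rule has_field_derivative_transform_within_open[OF der(3)[OF t] open_ball t])
      (simp add: e2)
  show "deriv \<psi> 0 = l (blinfun_apply (fderiv h 0) u)" using e1[of 0] by simp
  show "taylor_coeff \<psi> 2 = l (D2 h 0 u u) / 2"
    using e2[of 0] by (simp add: taylor_coeff_def numeral_2_eq_2 D2_def)
  show "taylor_coeff \<psi> 3 = l (D3 h 0 u u u) / 6"
    using e3[of 0] by (simp add: taylor_coeff_def numeral_3_eq_3)
qed

text \<open>The triangle inequality leaves a convex combination of 1 and \<open>cmod s\<close>, the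
  latter with weight \<open>(cmod c1)^2\<close>, which is at most the larger of the two.\<close>

lemma fekete_szego_bound:
  fixes c1 c2 s :: complex
  assumes "cmod c2 \<le> 1 - (cmod c1)\<^sup>2"
  shows "cmod (c2 + s * c1\<^sup>2) \<le> max 1 (cmod s)"
proof -
  have "cmod (c2 + s * c1\<^sup>2) \<le> cmod c2 + cmod (s * c1\<^sup>2)" by (rule norm_triangle_ineq)
  also have "\<dots> \<le> (1 - (cmod c1)\<^sup>2) * 1 + (cmod c1)\<^sup>2 * cmod s"
    using assms by (simp add: norm_mult norm_power mult.commute)
  also have "\<dots> \<le> (1 - (cmod c1)\<^sup>2) * max 1 (cmod s) + (cmod c1)\<^sup>2 * max 1 (cmod s)"
    using order_trans[OF norm_ge_zero assms] by (intro add_mono mult_left_mono) simp_all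
  also have "\<dots> = max 1 (cmod s)" by (simp add: algebra_simps)
  finally show ?thesis .
qed

text \<open>The computation is done for the unit vector \<open>u\<close> in the direction of
  \<open>B x\<close>: \<open>l\<close> supports \<open>u\<close> as well, so the coefficient
  relations apply to \<open>l (h (t u))\<close>, and powers of \<open>N = norm (B x)\<close> enter
  by homogeneity of the derivatives of \<open>h\<close>.\<close>

lemma coefficient_functional_bound:
  fixes A h J E :: "'a::complex_banach \<Rightarrow> 'a" and B :: "'a \<Rightarrow>\<^sub>L 'a"
    and g ghat :: "complex \<Rightarrow> complex" and l :: "'a \<Rightarrow> complex" and \<nu> \<tau> q1 q2 :: complex
  assumes A: "bounded_clinear A" "strongly_accretive A"
    and g: "biholomorphic_onto_image (ball 0 1) g"
    and V: "numerical_range A \<subseteq> g ` ball 0 1"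
    and h: "h \<in> class_N_sub A g" and r: "r > 0"
    and J: "J = resolvent h r" and E: "E = (\<lambda>y. y + r *\<^sub>R A y)" and B: "B = fderiv J 0"
    and x: "norm x = 1" and l: "l \<in> support_functionals (B x)"
    and \<tau>: "\<tau> = inv_into (ball 0 1) g (l (A (B x)) / complex_of_real (norm (B x)))"
    and ghat: "ghat = (\<lambda>t. g ((\<tau> - t) / (1 - t * cnj \<tau>)))"
    and q: "q1 = taylor_coeff ghat 1" "q2 = taylor_coeff ghat 2"
  defines "a2t \<equiv> l (E ((1 / fact 2) *\<^sub>R D2 J 0 x (E ((1 / fact 2) *\<^sub>R D2 J 0 x x))))"
    and "a2 \<equiv> l (E ((1 / fact 2) *\<^sub>R D2 J 0 x x))" and "a3 \<equiv> l (E ((1 / fact 3) *\<^sub>R D3 J 0 x x x))"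
  shows "B (E y) = y" and "E (B y) = y"
    and "cmod (a3 - 2 * a2t - (\<nu> - 2) * a2\<^sup>2) \<le> r * cmod q1 * norm (B x) * (norm B)\<^sup>2 *
      max 1 (cmod (q2 / q1 - (2 - \<nu>) * complex_of_real r * q1 * complex_of_real (norm (B x))))"
proof -
  have hN: "h \<in> class_N A" using h by (simp add: class_N_sub_def)
  then have hol: "h \<in> Hol (ball 0 1)" and h0: "h 0 = 0" and hA: "(h has_derivative A) (at 0)"
    by (auto simp: class_N_def)
  have A_eq: "blinfun_apply (fderiv h 0) = A" by (rule blinfun_apply_fderiv[OF hA])
  obtain \<delta> where \<delta>: "\<delta> > 0" "J \<in> Hol (ball 0 \<delta>)" "J 0 = 0"
    "\<And>z. z \<in> ball 0 \<delta> \<Longrightarrow> J z \<in> ball 0 1 \<and> J z + r *\<^sub>R h (J z) = z"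
    using resolvent_near_zero[OF A hN r] unfolding J by metis
  note der0 = resolvent_derivatives_at_zero[OF hol \<delta>, folded B, unfolded A_eq]
  have der: "E (B y) = y" "E (D2 J 0 y z) = - r *\<^sub>R D2 h 0 (B y) (B z)"
    "E (D3 J 0 y y y) = - r *\<^sub>R (D3 h 0 (B y) (B y) (B y) + 3 *\<^sub>R D2 h 0 (B y) (D2 J 0 y y))" for y z
    using der0[of y] der0(2)[of y z] unfolding E by blast+
  show EB: "E (B y) = y" for y by (rule der(1))
  have blA: "bounded_linear A" using A(1) by (rule bounded_clinear_linear)
  have linE: "linear E"
    unfolding E using blA by (intro linear_compose_add linear_ident bounded_linear.linear bounded_linear_const_scaleR)
  show BE: "B (E y) = y" for y
  proof -
    \<comment> \<open>\<open>EB\<close> makes \<open>B\<close> a right inverse of \<open>E\<close>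
      only; \<open>E\<close> does not shrink norms, hence is injective, and \<open>B\<close> is a
      left inverse too.\<close>
    have "norm (B (E y) - y) \<le> norm (E (B (E y) - y))"
      unfolding E using strongly_accretive_expanding[OF A(2), of r] r by simp
    also have "E (B (E y) - y) = 0" by (simp add: linear_diff[OF linE] EB)
    finally show ?thesis by simp
  qed
  define N where "N = norm (B x)"
  have "B x \<noteq> 0"
    using EB[of x] x linear_0[OF linE] by auto
  then have N: "N > 0" by (simp add: N_def)
  define u where "u = B x /\<^sub>R N"
  have u: "norm u = 1" using N by (simp add: u_def N_def)
  have Bx: "B x = N *\<^sub>R u" using N by (simp add: u_def)
  have lc: "bounded_clinear l" using l by (simp add: support_functionals_def)
  then have bl: "bounded_linear l" by (rule bounded_clinear_linear)
  have lsc: "l (c *\<^sub>C v) = c * l v" for c v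
    using bounded_clinear_scaleC[OF lc] by (simp add: scaleC_complex_def)
  have lsr: "l (c *\<^sub>R v) = of_real c * l v" for c v
    by (simp add: linear_simps(5)[OF bl] scaleR_conv_of_real)
  have lu: "l u = 1" using l N by (simp add: u_def lsr support_functionals_def N_def)
  have on: "onorm l = 1" using l by (simp add: support_functionals_def)
  define \<psi> where "\<psi> t = l (h (t *\<^sub>C u))" for t
  note \<psi> = taylor_coeff_along_line[OF hol lc u, folded \<psi>_def, unfolded A_eq]
  have supp_u: "l \<in> support_functionals u"
    using lc on lu u by (simp add: support_functionals_def)
  have lA: "l (A (B x)) / of_real (norm (B x)) = l (A u)"
    using N unfolding N_def[symmetric] by (simp add: Bx linear_simps(5)[OF blA] lsr)
  have lAu: "l (A u) \<in> g ` ball 0 1"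
    using V supp_u u by (auto simp: numerical_range_def)
  \<comment> \<open>\<open>l (A u)\<close> belongs to the numerical range because \<open>u\<close>
    is a unit vector, so \<open>inv_into\<close> returns a genuine preimage.\<close>
  have \<tau>_ball: "\<tau> \<in> ball 0 1" and g\<tau>: "g \<tau> = deriv \<psi> 0"
    unfolding \<tau> lA \<psi>(2) by (rule inv_into_into[OF lAu], rule f_inv_into_f[OF lAu])
  have range: "\<psi> t / t \<in> g ` ball 0 1" if t: "t \<in> ball 0 1" "t \<noteq> 0" for t
  proof -
    \<comment> \<open>rotating \<open>l\<close> by the phase of \<open>t\<close> gives a support functional at \<open>t u\<close>\<close>
    define \<kappa> where "\<kappa> = of_real (cmod t) / t"
    have \<kappa>: "cmod \<kappa> = 1" using t by (simp add: \<kappa>_def norm_divide)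
    let ?l = "\<lambda>v. \<kappa> * l v"
    have "bounded_clinear ?l"
      unfolding bounded_clinear_def
      using bounded_linear_compose[OF bounded_linear_mult_right bl, of \<kappa>] by (simp add: lsc scaleC_complex_def)
    moreover have "onorm ?l = 1"
      using on by (simp add: onorm_def norm_mult \<kappa>)
    ultimately have "?l \<in> support_functionals (t *\<^sub>C u)"
      using t by (simp add: support_functionals_def lsc lu u norm_scaleC \<kappa>_def)
    moreover have "t *\<^sub>C u \<in> ball 0 1 - {0}"
      using t u by (auto simp: norm_scaleC simp flip: norm_eq_zero[of "t *\<^sub>C u"])
    ultimately have "\<kappa> * l (h (t *\<^sub>C u)) / of_real (norm (t *\<^sub>C u)) \<in> g ` ball 0 1"
      using h unfolding class_N_sub_def by (auto dest: bspec)
    then show ?thesis using t by (simp add: \<kappa>_def \<psi>_def norm_scaleC u)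
  qed
  have \<psi>0: "\<psi> 0 = 0" by (simp add: \<psi>_def h0 linear_simps(3)[OF bl])
  obtain c1 c2 where c: "cmod c2 \<le> 1 - (cmod c1)\<^sup>2" and q1: "q1 \<noteq> 0"
    and t2: "taylor_coeff \<psi> 2 = q1 * c1" and t3: "taylor_coeff \<psi> 3 = q1 * c2 + q2 * c1\<^sup>2"
    by (rule subordinate_coefficients[OF g \<psi>(1) \<psi>0 \<tau>_ball g\<tau> range, folded ghat, folded q])
  let ?y = "blinfun_apply B x"
  have D2y: "l (D2 h 0 ?y ?y) = of_real N ^ 2 * (2 * (q1 * c1))"
    unfolding Bx t2[symmetric] \<psi>(3)
    by (simp add: D2_def blinfun.scaleR_left blinfun.scaleR_right lsr power2_eq_square)
  have D3y: "l (D3 h 0 ?y ?y ?y) = of_real N ^ 3 * (6 * (q1 * c2 + q2 * c1\<^sup>2))"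
    unfolding Bx t3[symmetric] \<psi>(4)
    by (simp add: D3_def blinfun.scaleR_left blinfun.scaleR_right lsr power3_eq_cube)
  note Esc = linear_scale[OF linE]
  have a2: "a2 = - of_real r * of_real N ^ 2 * q1 * c1"
    unfolding a2_def Esc der(2) by (simp add: lsr D2y linear_simps(4)[OF bl])
  have a2t: "a2t = - of_real r / 4 * l (D2 h 0 ?y (D2 J 0 x x))"
  proof -
    define w where "w = E ((1 / fact 2) *\<^sub>R D2 J 0 x x)"
    \<comment> \<open>\<open>B\<close> undoes \<open>E\<close>, so the nested expression collapses
      to the mixed term of \<open>a3\<close>.\<close>
    have Bw: "B w = (1 / 2) *\<^sub>R D2 J 0 x x" by (simp add: w_def BE)
    have "a2t = l (E ((1 / fact 2) *\<^sub>R D2 J 0 x w))" by (simp only: a2t_def w_def)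
    also have "\<dots> = - of_real r / 2 * l (D2 h 0 ?y (B w))"
      unfolding Esc der(2) by (simp add: lsr linear_simps(4)[OF bl])
    also have "\<dots> = - of_real r / 4 * l (D2 h 0 ?y (D2 J 0 x x))"
      by (simp add: Bw D2_def blinfun.scaleR_right lsr)
    finally show ?thesis .
  qed
  have a3: "a3 = - of_real r / 6 * (l (D3 h 0 ?y ?y ?y) + 3 * l (D2 h 0 ?y (D2 J 0 x x)))"
    unfolding a3_def Esc der(3) by (simp add: lsr fact_numeral linear_simps(1,4)[OF bl])
  define s where "s = q2 / q1 - (2 - \<nu>) * of_real r * q1 * of_real N"
  \<comment> \<open>The mixed term enters \<open>a3\<close> with coefficient \<open>- r / 2\<close>
    and \<open>a2t\<close> with \<open>- r / 4\<close>, hence drops out. Taking out the factor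
    \<open>- r q1 N^3\<close> collects the coefficients of \<open>c1^2\<close> into
    \<open>s\<close>.\<close>
  have "a3 - 2 * a2t - (\<nu> - 2) * a2\<^sup>2 = - of_real r * q1 * of_real N ^ 3 * (c2 + s * c1\<^sup>2)"
    using q1 unfolding a3 a2t a2 D3y s_def by (simp add: field_simps power2_eq_square power3_eq_cube)
  then have "cmod (a3 - 2 * a2t - (\<nu> - 2) * a2\<^sup>2) = r * cmod q1 * N ^ 3 * cmod (c2 + s * c1\<^sup>2)"
    using r N by (simp add: norm_mult norm_power)
  also have "\<dots> \<le> r * cmod q1 * (N * (norm B)\<^sup>2) * max 1 (cmod s)"
  proof (intro mult_mono mult_left_mono fekete_szego_bound[OF c])
    \<comment> \<open>Only two of the three factors \<open>N\<close> are replaced by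
      \<open>norm B\<close>; the third remains as \<open>norm (B x)\<close> in the bound.\<close>
    have "N \<le> norm B" using norm_blinfun[of B x] x by (simp add: N_def)
    then have "N\<^sup>2 \<le> (norm B)\<^sup>2" using N by (intro power_mono) auto
    then show "N ^ 3 \<le> N * (norm B)\<^sup>2" using N by (simp add: power3_eq_cube power2_eq_square mult_left_mono)
  qed (use r N in auto)
  finally show "cmod (a3 - 2 * a2t - (\<nu> - 2) * a2\<^sup>2) \<le> r * cmod q1 * norm (B x) * (norm B)\<^sup>2 *
      max 1 (cmod (q2 / q1 - (2 - \<nu>) * complex_of_real r * q1 * complex_of_real (norm (B x))))"
    by (simp add: s_def N_def mult.assoc)
qed

theorem theorem5p1:
  fixes A h J E :: "'a::complex_banach \<Rightarrow> 'a"
    and B :: "'a \<Rightarrow>\<^sub>L 'a"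
    and g ghat :: "complex \<Rightarrow> complex"
    and r \<rho> Q :: real
    and x :: 'a
    and l :: "'a \<Rightarrow> complex"
    and a2t a2 a3 \<nu> \<tau> q1 q2 :: complex
  assumes "bounded_clinear A" and "strongly_accretive A"
    and "biholomorphic_onto_image (ball 0 1) g"
    and "g \<prec> (\<lambda>z. (1 + z) / (1 - z))"
    and "closure (numerical_range A) \<subseteq> g ` ball 0 1"
    and "h \<in> class_N_sub A g"
    and "r > 0"
    and "J = resolvent h r"
    and "E = (\<lambda>y. y + r *\<^sub>R A y)"
    and "B = fderiv J 0"
    and "\<rho> = norm B"
    and "x \<in> sphere 0 1"
    and "l \<in> support_functionals (B x)"
    and "a2t = l (E ((1 / fact 2) *\<^sub>R D2 J 0 x (E ((1 / fact 2) *\<^sub>R D2 J 0 x x))))"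
    and "a2 = l (E ((1 / fact 2) *\<^sub>R D2 J 0 x x))"
    and "a3 = l (E ((1 / fact 3) *\<^sub>R D3 J 0 x x x))"
    and "\<tau> = inv_into (ball 0 1) g (l (A (B x)) / complex_of_real (norm (B x)))"
    and "ghat = (\<lambda>t. g ((\<tau> - t) / (1 - t * cnj \<tau>)))"
    and "q1 = taylor_coeff ghat 1" and "q2 = taylor_coeff ghat 2"
    and "Q = cmod (q2 / q1 - (2 - \<nu>) * complex_of_real r * q1 * complex_of_real (norm (B x)))"
  shows "(blinfun_apply B \<circ> E = id \<and> E \<circ> blinfun_apply B = id) \<and>
    cmod (a3 - 2 * a2t - (\<nu> - 2) * a2\<^sup>2) \<le> r * cmod q1 * norm (B x) * \<rho>\<^sup>2 * max 1 Q"
proof -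
  have "numerical_range A \<subseteq> g ` ball 0 1" using assms(5) closure_subset by blast
  moreover have "norm x = 1" using assms(12) by simp
  ultimately show ?thesis
    using coefficient_functional_bound[OF assms(1,2,3) _ assms(6-10) _ assms(13,17-20)]
    unfolding assms(11,14-16,21) by (simp add: fun_eq_iff)
qed

end
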